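(* Let $(B_\gamma(t))_{t\in[0,T]}$, $\gamma\in\Gamma=\{0,\dots,P_\eta-1\}$, be the branches of a Brownian decision tree on $[0,T]$ with branching points $0<\tau_1<\dots<\tau_\eta<T$ and offspring numbers $N_1,\dots,N_\eta\ge 1$, where $P_\eta=\prod_{j=1}^\eta N_j$. Then, as $u\to\infty$, $$\mathbb{P}\{\exists\, t\in[0,T],\ \exists\,\gamma_1,\gamma_2\in\Gamma:\ B_{\gamma_1}(t)-B_{\gamma_2}(t)>u\}\sim P_\eta^2\,\frac{N_1-1}{N_1}\,\frac{2\sqrt{T-\tau_1}}{u\sqrt{\pi}}\exp\left(-\frac{u^2}{4(T-\tau_1)}\right).$$
   Context: Brownian decision tree. Fix $T>0$, an integer $\eta\ge 1$, deterministic branching points $0<\tau_1<\dots<\tau_\eta<T$ and integers $N_1,\dots,N_\eta\ge 1$. Conventions: $\tau_0=0$, $\tau_{\eta+1}=T$, $P_0=1$. Put $P_i=\prod_{j=1}^iN_j$, $\Gamma=\{0,1,\dots,P_\eta-1\}$, and let $i(t)=\max\{i\in\{1,\dots,\eta\}: t>\tau_i\}$ for $t>\tau_1$, $i(t)=0$ for $t\in[0,\tau_1]$. Let $B_0^*$ be a standard one-dimensional Brownian motion and, for $i=1,\dots,\eta$, let $\boldsymbol{B}_i^*$ be a standard $\mathbb{R}^{P_i}$-valued Brownian motion (independent components), all of these being mutually independent. Define $\widetilde{\boldsymbol{B}}_\Gamma(t)=B_0^*(t)$ for $t\in[0,\tau_1]$ and, recursively for $t\in(\tau_i,\tau_{i+1}]$,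 let $\widetilde{\boldsymbol{B}}_\Gamma(t)\in\mathbb{R}^{P_i}$ be the vector obtained by stacking $N_i$ copies of $\widetilde{\boldsymbol{B}}_\Gamma(\tau_i)\in\mathbb{R}^{P_{i-1}}$, plus $\boldsymbol{B}_i^*(t-\tau_i)$. The branch indexed by $\gamma\in\Gamma$ is $B_\gamma(t)=(\widetilde{\boldsymbol{B}}_\Gamma(t))_{(\gamma \bmod P_{i(t)})+1}$. The notation $f(u)\sim g(u)$ means $f(u)/g(u)\to1$.
   Formalization: For N_1 = 1 the right-hand side is identically 0, so "~" (quotient tending to 1) is undefined; in that case the claim is read as: the probability is o of the right-hand side without the factor P_η²(N_1−1)/N_1. For N_1 ≥ 2 it is as stated. *)

theory Defs
  imports "HOL-Probability.Probability" "HOL-Library.Landau_Symbols"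
begin

text \<open>
  Processes are maps from time and sample point to \<^typ>\<open>real\<close>; only nonnegative times matter.
  Starting at 0 and continuity of paths are required for every sample point, so that
  events about suprema of paths are measurable without completing the measure.
\<close>

definition standard_BM :: "'a measure \<Rightarrow> (real \<Rightarrow> 'a \<Rightarrow> real) \<Rightarrow> bool" where
  "standard_BM M X \<longleftrightarrow>
     (\<forall>t\<ge>0. X t \<in> borel_measurable M) \<and>
     (\<forall>\<omega>\<in>space M. X 0 \<omega> = 0) \<and>
     (\<forall>\<omega>\<in>space M. continuous_on {0..} (\<lambda>t. X t \<omega>)) \<and>
     (\<forall>s t. 0 \<le> s \<and> s < t \<longrightarrow>
        distributed M lborel (\<lambda>\<omega>. X t \<omega> - X s \<omega>) (\<lambda>x. ennreal (normal_density 0 (sqrt (t - s)) x))) \<and>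
     (\<forall>n (t :: nat \<Rightarrow> real). 0 \<le> t 0 \<and> (\<forall>j<n. t j < t (Suc j)) \<longrightarrow>
        prob_space.indep_vars M (\<lambda>_. borel) (\<lambda>j \<omega>. X (t (Suc j)) \<omega> - X (t j) \<omega>) {..<n})"

text \<open>
  Independence of processes is independence of the path-valued random variables, with the
  product \<open>\<sigma>\<close>-algebra on path space.
\<close>

definition standard_vector_BM :: "'a measure \<Rightarrow> nat \<Rightarrow> (nat \<Rightarrow> real \<Rightarrow> 'a \<Rightarrow> real) \<Rightarrow> bool" where
  "standard_vector_BM M d X \<longleftrightarrow>
     (\<forall>k<d. standard_BM M (X k)) \<and>
     prob_space.indep_vars M (\<lambda>_. \<Pi>\<^sub>M t\<in>{0..}. borel) (\<lambda>k \<omega>. \<lambda>t\<in>{0..}. X k t \<omega>) {..<d}"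

definition offspring_prod :: "(nat \<Rightarrow> nat) \<Rightarrow> nat \<Rightarrow> nat" where
  "offspring_prod N i = (\<Prod>j=1..i. N j)"

text \<open>
  \<open>W i k\<close> is the \<open>k\<close>-th coordinate, counted from 0, of the driving motion of stage \<open>i\<close>.
\<close>

definition tree_driver ::
  "'a measure \<Rightarrow> nat \<Rightarrow> (nat \<Rightarrow> nat) \<Rightarrow> (nat \<Rightarrow> nat \<Rightarrow> real \<Rightarrow> 'a \<Rightarrow> real) \<Rightarrow> bool" where
  "tree_driver M \<eta> N W \<longleftrightarrow>
     (\<forall>i\<le>\<eta>. standard_vector_BM M (offspring_prod N i) (W i)) \<and>
     prob_space.indep_vars M
       (\<lambda>i. \<Pi>\<^sub>M kt\<in>{..<offspring_prod N i} \<times> {0..}. borel)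
       (\<lambda>i \<omega>. \<lambda>kt\<in>{..<offspring_prod N i} \<times> {0..}. W i (fst kt) (snd kt) \<omega>) {..\<eta>}"

definition tree_stage :: "nat \<Rightarrow> (nat \<Rightarrow> real) \<Rightarrow> real \<Rightarrow> nat" where
  "tree_stage \<eta> \<tau> t = (if t \<le> \<tau> 1 then 0 else Max {i \<in> {1..\<eta>}. \<tau> i < t})"

text \<open>
  \<open>tree_segment N \<tau> W i k t\<close> is the \<open>k\<close>-th coordinate, counted from 0, of the tree at a time \<open>t\<close>
  with \<open>tree_stage \<eta> \<tau> t = i\<close>. Coordinate \<open>k\<close> of a stack of copies of a vector of length \<open>P\<close>
  is coordinate \<open>k mod P\<close> of that vector.
\<close>

primrec tree_segment ::
  "(nat \<Rightarrow> nat) \<Rightarrow> (nat \<Rightarrow> real) \<Rightarrow> (nat \<Rightarrow> nat \<Rightarrow> real \<Rightarrow> 'a \<Rightarrow> real) \<Rightarrow> nat \<Rightarrow> nat \<Rightarrow> real \<Rightarrow> 'a \<Rightarrow> real"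
where
  "tree_segment N \<tau> W 0 k t \<omega> = W 0 k t \<omega>"
| "tree_segment N \<tau> W (Suc i) k t \<omega> =
     tree_segment N \<tau> W i (k mod offspring_prod N i) (\<tau> (Suc i)) \<omega> + W (Suc i) k (t - \<tau> (Suc i)) \<omega>"

definition tree_branch ::
  "nat \<Rightarrow> (nat \<Rightarrow> nat) \<Rightarrow> (nat \<Rightarrow> real) \<Rightarrow> (nat \<Rightarrow> nat \<Rightarrow> real \<Rightarrow> 'a \<Rightarrow> real) \<Rightarrow> nat \<Rightarrow> real \<Rightarrow> 'a \<Rightarrow> real"
where
  "tree_branch \<eta> N \<tau> W \<gamma> t \<omega> =
     (let i = tree_stage \<eta> \<tau> t in tree_segment N \<tau> W i (\<gamma> mod offspring_prod N i) t \<omega>)"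

definition tree_spread_event ::
  "'a measure \<Rightarrow> real \<Rightarrow> nat \<Rightarrow> (nat \<Rightarrow> nat) \<Rightarrow> (nat \<Rightarrow> real) \<Rightarrow> (nat \<Rightarrow> nat \<Rightarrow> real \<Rightarrow> 'a \<Rightarrow> real) \<Rightarrow> real \<Rightarrow> 'a set"
where
  "tree_spread_event M T \<eta> N \<tau> W u =
     {\<omega> \<in> space M. \<exists>t\<in>{0..T}. \<exists>\<gamma>1\<in>{0..<offspring_prod N \<eta>}. \<exists>\<gamma>2\<in>{0..<offspring_prod N \<eta>}.
        tree_branch \<eta> N \<tau> W \<gamma>1 t \<omega> - tree_branch \<eta> N \<tau> W \<gamma>2 t \<omega> > u}"

unbundle asymp_equiv_syntax

end

theory Submission
  imports Defs
begin

text \<open>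
  The difference of two branches vanishes until the branches part, and from then on it is
  \<open>sqrt 2\<close> times a Brownian motion. For an ordered pair that parts at \<open>\<tau> 1\<close> the reflection
  principle gives the probability \<open>2 * P (X > u)\<close> of passing the level \<open>u\<close> before \<open>T\<close>, where \<open>X\<close> is
  centred normal with variance \<open>2 * (T - \<tau> 1)\<close>. By Mills' ratio this is asymptotically
  \<open>2 * sqrt (T - \<tau> 1) / (u * sqrt pi) * exp (- u\<^sup>2 / (4 * (T - \<tau> 1)))\<close>, and there are
  \<open>P\<^sub>\<eta>\<^sup>2 * (N 1 - 1) / N 1\<close> such pairs. A pair that parts later has a smaller variance at \<open>T\<close>, hence an
  exponentially smaller passage probability. The union bound gives the upper estimate
  (\<open>spread_upper_bound\<close>). By Bonferroni's inequality the lower estimate (\<open>spread_lower_bound\<close>)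
  holds as soon as two different pairs are exponentially unlikely to pass \<open>u\<close> together
  (\<open>joint_passage_exp_bound\<close>).

  For the joint passage, fix a small \<open>h\<close> and a small \<open>\<theta>\<close>. Passing \<open>u\<close> before \<open>T - h\<close> is negligible because
  the variance is smaller by \<open>2 * h\<close>; moving by \<open>\<theta> * u\<close> during the last \<open>h\<close> units of time is negligible if
  \<open>h\<close> is small against \<open>\<theta>\<^sup>2\<close>. What remains is that both differences exceed \<open>(1 - \<theta>) * u\<close> at \<open>T - h\<close>.
  The variance of their sum is at most \<open>8 * (T - \<tau> 1) - 2 * (T - \<tau> \<eta>)\<close>: two identical differences would
  give the rate 8, but after \<open>\<tau> \<eta>\<close> all branches move independently, so that two different pairs share at
  most one branch with the same sign and the rate drops to 6. This strict loss absorbs \<open>\<theta>\<close>.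

  Continuous time is reached through grids that cut each stage into \<open>n\<close> equal pieces. At
  grid times the tree is a branching random walk with independent normal steps, for which reflection takes
  the form of two inequalities: \<open>levy_maximal_inequality\<close>, and \<open>reflection_lower_bound\<close>, whose error term is
  the chance of a big step and vanishes as the mesh tends to 0. By continuity of paths the passage events of the
  grids increase to the event in continuous time (\<open>grid_event_limit\<close>).

  Both estimates match a multiple of the main term up to a factor that tends to 1 and exponentially smaller
  errors, so they yield one limit
  (\<open>spread_ratio_limit\<close>) that covers \<open>N 1 \<ge> 2\<close> and, with an empty set of pairs that part at \<open>\<tau> 1\<close>,
  also \<open>N 1 = 1\<close>.
\<close>

section \<open>Centred normal variables and their tails\<close>

text \<open>
  The variance 0 is admitted, with the value 0 at every sample point, because the difference of two branches
  is identically 0 until they part.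
\<close>

definition (in prob_space) centred_normal :: "('a \<Rightarrow> real) \<Rightarrow> real \<Rightarrow> bool" where
  "centred_normal X v \<longleftrightarrow> random_variable borel X \<and>
     (if v = 0 then \<forall>\<omega>\<in>space M. X \<omega> = 0
      else 0 < v \<and> distributed M lborel X (\<lambda>x. ennreal (normal_density 0 (sqrt v) x)))"

context prob_space
begin

lemma centred_normal_measurable: "centred_normal X v \<Longrightarrow> random_variable borel X"
  by (simp add: centred_normal_def)

lemma centred_normal_cong:
  assumes "centred_normal X v" "\<And>\<omega>. \<omega> \<in> space M \<Longrightarrow> X \<omega> = Y \<omega>"
  shows "centred_normal Y v"
proof -
  have "random_variable borel Y"
    using centred_normal_measurable[OF assms(1)] assms(2) by (simp cong: measurable_cong)
  moreover have "distr M lborel X = distr M lborel Y"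
    using assms(2) by (intro distr_cong) auto
  ultimately show ?thesis
    using assms by (auto simp: centred_normal_def distributed_def split: if_splits)
qed

lemma centred_normal_scale:
  assumes "centred_normal X v"
  shows "centred_normal (\<lambda>\<omega>. c * X \<omega>) (c\<^sup>2 * v)"
proof (cases "c = 0 \<or> v = 0")
  case True
  then show ?thesis using assms by (auto simp: centred_normal_def)
next
  case False
  then have v: "0 < v" "c \<noteq> 0"
    and d: "distributed M lborel X (\<lambda>x. ennreal (normal_density 0 (sqrt v) x))"
    and m: "random_variable borel X"
    using assms by (auto simp: centred_normal_def split: if_splits)
  have "distributed M lborel (\<lambda>x. 0 + c * X x) (\<lambda>x. ennreal (normal_density (0 + c * 0) (\<bar>c\<bar> * sqrt v) x))"
    using v by (intro normal_density_affine d) auto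
  moreover have "\<bar>c\<bar> * sqrt v = sqrt (c\<^sup>2 * v)"
    by (simp add: real_sqrt_mult)
  ultimately show ?thesis
    using v m by (simp add: centred_normal_def)
qed

text \<open>
  Terms of variance 0 vanish identically. They are split off, because a normal density needs a
  positive variance.
\<close>

lemma centred_normal_sum:
  assumes fin: "finite I" and ind: "indep_vars (\<lambda>_. borel) X I"
    and X: "\<And>i. i \<in> I \<Longrightarrow> centred_normal (X i) (v i)"
  shows "centred_normal (\<lambda>\<omega>. \<Sum>i\<in>I. c i * X i \<omega>) (\<Sum>i\<in>I. (c i)\<^sup>2 * v i)"
proof -
  have v0: "0 \<le> v i" if "i \<in> I" for i
    using X[OF that] by (auto simp: centred_normal_def split: if_splits)
  define J where "J = {i \<in> I. (c i)\<^sup>2 * v i \<noteq> 0}"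
  have J: "J \<subseteq> I" "finite J" using fin by (auto simp: J_def)
  have sc: "centred_normal (\<lambda>\<omega>. c i * X i \<omega>) ((c i)\<^sup>2 * v i)" if "i \<in> I" for i
    by (rule centred_normal_scale[OF X[OF that]])
  have m: "random_variable borel (\<lambda>\<omega>. \<Sum>i\<in>I. c i * X i \<omega>)"
    using X by (intro borel_measurable_sum borel_measurable_times) (auto dest: centred_normal_measurable)
  have zero: "c i * X i \<omega> = 0" if "i \<in> I - J" "\<omega> \<in> space M" for i \<omega>
    using sc[of i] that by (auto simp: J_def centred_normal_def)
  have eqX: "(\<Sum>i\<in>I. c i * X i \<omega>) = (\<Sum>i\<in>J. c i * X i \<omega>)" if "\<omega> \<in> space M" for \<omega>
    using zero[OF _ that] J fin by (intro sum.mono_neutral_right) auto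
  have eqv: "(\<Sum>i\<in>I. (c i)\<^sup>2 * v i) = (\<Sum>i\<in>J. (c i)\<^sup>2 * v i)"
    using fin by (intro sum.mono_neutral_right) (auto simp: J_def)
  have "centred_normal (\<lambda>\<omega>. \<Sum>i\<in>J. c i * X i \<omega>) (\<Sum>i\<in>J. (c i)\<^sup>2 * v i)"
  proof (cases "J = {}")
    case True then show ?thesis by (simp add: centred_normal_def)
  next
    case False
    have pos: "0 < (c i)\<^sup>2 * v i" if "i \<in> J" for i
      using that v0[of i] by (auto simp: J_def less_le)
    then have spos: "0 < (\<Sum>i\<in>J. (c i)\<^sup>2 * v i)"
      using J False by (intro sum_pos) auto
    have ind': "indep_vars (\<lambda>_. borel) (\<lambda>i \<omega>. c i * X i \<omega>) J"
      by (rule indep_vars_compose2[where Y="\<lambda>i x. c i * x" and X=X])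
        (use indep_vars_subset[OF ind J(1)] in auto)
    have d: "distributed M lborel (\<lambda>\<omega>. c i * X i \<omega>)
        (\<lambda>x. ennreal (normal_density 0 (sqrt ((c i)\<^sup>2 * v i)) x))" if "i \<in> J" for i
      using sc[OF subsetD[OF J(1) that]] pos[OF that] by (auto simp: centred_normal_def split: if_splits)
    have "distributed M lborel (\<lambda>\<omega>. \<Sum>i\<in>J. c i * X i \<omega>)
       (\<lambda>x. ennreal (normal_density (\<Sum>i\<in>J. 0) (sqrt (\<Sum>i\<in>J. (sqrt ((c i)\<^sup>2 * v i))\<^sup>2)) x))"
      using J False pos ind' d by (intro sum_indep_normal) auto
    moreover have "(\<Sum>i\<in>J. (sqrt ((c i)\<^sup>2 * v i))\<^sup>2) = (\<Sum>i\<in>J. (c i)\<^sup>2 * v i)"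
      using pos by (intro sum.cong) (auto intro: real_sqrt_pow2 less_imp_le)
    ultimately show ?thesis
      using spos by (auto simp: centred_normal_def dest: distributed_measurable)
  qed
  then show ?thesis
    unfolding eqv by (rule centred_normal_cong) (simp add: eqX)
qed

lemma centred_normal_symmetric:
  assumes "centred_normal X v"
  shows "prob {\<omega>\<in>space M. X \<omega> > x} = prob {\<omega>\<in>space M. X \<omega> < - x}"
proof (cases "v = 0")
  case True
  then show ?thesis using assms
    by (intro arg_cong[where f=prob]) (auto simp: centred_normal_def)
next
  case False
  then have d: "distributed M lborel X (\<lambda>x. ennreal (normal_density 0 (sqrt v) x))"
    using assms by (auto simp: centred_normal_def)
  have d': "distributed M lborel (\<lambda>\<omega>. (-1) * X \<omega>) (\<lambda>x. ennreal (normal_density 0 (sqrt v) x))"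
    using centred_normal_scale[OF assms, of "-1"] False by (auto simp: centred_normal_def)
  have "emeasure M (X -` {x<..} \<inter> space M) = emeasure M ((\<lambda>\<omega>. (-1) * X \<omega>) -` {x<..} \<inter> space M)"
    by (subst distributed_emeasure[OF d], simp, subst distributed_emeasure[OF d']) auto
  moreover have "X -` {x<..} \<inter> space M = {\<omega>\<in>space M. X \<omega> > x}" by auto
  moreover have "(\<lambda>\<omega>. (-1) * X \<omega>) -` {x<..} \<inter> space M = {\<omega>\<in>space M. X \<omega> < - x}" by auto
  ultimately show ?thesis by (simp add: measure_def)
qed

lemma centred_normal_nonneg_ge_half:
  assumes "centred_normal X v"
  shows "1 / 2 \<le> prob {\<omega>\<in>space M. X \<omega> \<ge> 0}"
proof -
  note [measurable] = centred_normal_measurable[OF assms]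
  have "1 = prob ({\<omega>\<in>space M. X \<omega> \<ge> 0} \<union> {\<omega>\<in>space M. X \<omega> < 0})"
    using prob_space by (auto intro!: arg_cong[where f=prob, symmetric] simp flip: prob_space)
  also have "\<dots> \<le> prob {\<omega>\<in>space M. X \<omega> \<ge> 0} + prob {\<omega>\<in>space M. X \<omega> < 0}"
    by (intro measure_Un_le) auto
  also have "prob {\<omega>\<in>space M. X \<omega> < 0} = prob {\<omega>\<in>space M. X \<omega> > 0}"
    using centred_normal_symmetric[OF assms, of 0] by simp
  also have "\<dots> \<le> prob {\<omega>\<in>space M. X \<omega> \<ge> 0}"
    by (intro finite_measure_mono) auto
  finally show ?thesis by simp
qed

lemma centred_normal_tail_eq:
  assumes "centred_normal X v" "0 < v"
  shows "ennreal (prob {\<omega>\<in>space M. X \<omega> > x}) =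
    (\<integral>\<^sup>+y. ennreal (normal_density 0 (sqrt v) y) * indicator {x<..} y \<partial>lborel)"
proof -
  have d: "distributed M lborel X (\<lambda>x. ennreal (normal_density 0 (sqrt v) x))"
    using assms by (auto simp: centred_normal_def)
  have "{\<omega>\<in>space M. X \<omega> > x} = X -` {x<..} \<inter> space M" by auto
  then show ?thesis
    using distributed_emeasure[OF d, of "{x<..}"] by (simp add: emeasure_eq_measure)
qed

text \<open>
  For \<open>x, y \<ge> 0\<close> the density at \<open>x + y\<close> is at most \<open>exp (- x\<^sup>2 / (2 * v))\<close> times the density at \<open>y\<close>. The
  upper bound \<open>w\<close> on the variance is what the estimates for the tree provide.
\<close>

lemma centred_normal_tail_exp:
  assumes X: "centred_normal X v" and "v \<le> w" "0 < w" "0 \<le> x"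
  shows "prob {\<omega>\<in>space M. X \<omega> > x} \<le> exp (- (x\<^sup>2 / (2 * w)))"
proof (cases "v = 0")
  case True
  then have e: "{\<omega>\<in>space M. X \<omega> > x} = {}" using X \<open>0 \<le> x\<close> by (auto simp: centred_normal_def)
  show ?thesis unfolding e by simp
next
  case False
  then have v: "0 < v" using X by (auto simp: centred_normal_def)
  let ?d = "normal_density 0 (sqrt v)"
  have "ennreal (prob {\<omega>\<in>space M. X \<omega> > x}) = (\<integral>\<^sup>+y. ennreal (?d y) * indicator {x<..} y \<partial>lborel)"
    by (rule centred_normal_tail_eq[OF X v])
  also have "\<dots> = (\<integral>\<^sup>+y. ennreal (?d (x + 1 * y)) * indicator {x<..} (x + 1 * y) \<partial>lborel)"
    by (subst nn_integral_real_affine[where c=1 and t=x]) auto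
  also have "\<dots> \<le> (\<integral>\<^sup>+y. ennreal (exp (- (x\<^sup>2 / (2 * v)))) * ennreal (?d y) \<partial>lborel)"
  proof (intro nn_integral_mono)
    fix y :: real
    have "?d (x + y) \<le> exp (- (x\<^sup>2 / (2 * v))) * ?d y" if "0 < y"
    proof -
      have "- ((x + y)\<^sup>2 / (2 * v)) \<le> - (x\<^sup>2 / (2 * v)) - y\<^sup>2 / (2 * v)"
        using v that \<open>0 \<le> x\<close> by (simp add: field_simps power2_eq_square)
      then have "exp (- ((x + y)\<^sup>2 / (2 * v))) \<le> exp (- (x\<^sup>2 / (2 * v)) - y\<^sup>2 / (2 * v))" by simp
      also have "\<dots> = exp (- (x\<^sup>2 / (2 * v))) * exp (- (y\<^sup>2 / (2 * v)))" by (simp flip: exp_add)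
      finally show ?thesis
        using v by (simp add: normal_density_def divide_right_mono)
    qed
    then show "ennreal (?d (x + 1 * y)) * indicator {x<..} (x + 1 * y)
        \<le> ennreal (exp (- (x\<^sup>2 / (2 * v)))) * ennreal (?d y)"
      by (auto simp: indicator_def ennreal_mult'[symmetric])
  qed
  also have "\<dots> = ennreal (exp (- (x\<^sup>2 / (2 * v)))) * (\<integral>\<^sup>+y. ennreal (?d y) \<partial>lborel)"
    by (subst nn_integral_cmult) auto
  also have "(\<integral>\<^sup>+y. ennreal (?d y) \<partial>lborel) = 1"
    using prob_space.emeasure_space_1[OF prob_space_normal_density[of "sqrt v" 0]] v
    by (simp add: emeasure_density)
  finally have "prob {\<omega>\<in>space M. X \<omega> > x} \<le> exp (- (x\<^sup>2 / (2 * v)))" by simp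
  also have "\<dots> \<le> exp (- (x\<^sup>2 / (2 * w)))"
    using v assms by (simp add: frac_le)
  finally show ?thesis .
qed

text \<open>
  The right-hand side, as a function of \<open>x\<close>, is minus an antiderivative of the integrand. Since the extra
  factor lies between 1 and \<open>1 + v / x\<^sup>2\<close> on the domain of integration, the Gaussian tail is known up to
  that factor.
\<close>

lemma gaussian_mills_integral:
  assumes "0 < v" "0 < x"
  shows "(\<integral>\<^sup>+y. ennreal ((1 + v / y\<^sup>2) * normal_density 0 (sqrt v) y) * indicator {x..} y \<partial>lborel)
    = ennreal (sqrt v / (x * sqrt (2 * pi)) * exp (- (x\<^sup>2 / (2 * v))))"
proof -
  define c where "c = sqrt v / sqrt (2 * pi)"
  let ?F = "\<lambda>y. - (c / y * exp (- (y\<^sup>2 / (2 * v))))"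
  have "(\<integral>\<^sup>+y. ennreal ((1 + v / y\<^sup>2) * normal_density 0 (sqrt v) y) * indicator {x..} y \<partial>lborel)
    = ennreal (0 - ?F x)"
  proof (rule nn_integral_FTC_atLeast)
    fix y assume y: "x \<le> y"
    then have "0 < y" using assms by simp
    have "DERIV ?F y :> c / y\<^sup>2 * exp (- (y\<^sup>2 / (2 * v))) + c / v * exp (- (y\<^sup>2 / (2 * v)))"
      using \<open>0 < y\<close> assms by (auto intro!: derivative_eq_intros simp: field_simps power2_eq_square)
    also have "c / y\<^sup>2 * exp (- (y\<^sup>2 / (2 * v))) + c / v * exp (- (y\<^sup>2 / (2 * v)))
       = (1 + v / y\<^sup>2) * (c / v * exp (- (y\<^sup>2 / (2 * v))))"
      using \<open>0 < y\<close> assms by (simp add: field_simps)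
    also have "c / v = 1 / sqrt (2 * pi * v)"
      using assms by (simp add: c_def real_sqrt_mult real_div_sqrt field_simps)
    also have "1 / sqrt (2 * pi * v) * exp (- (y\<^sup>2 / (2 * v))) = normal_density 0 (sqrt v) y"
      using assms by (simp add: normal_density_def)
    finally show "DERIV ?F y :> (1 + v / y\<^sup>2) * normal_density 0 (sqrt v) y" .
    show "0 \<le> (1 + v / y\<^sup>2) * normal_density 0 (sqrt v) y" using assms by simp
  next
    have "filterlim (\<lambda>y::real. 1 / (2 * v) * y\<^sup>2) at_top at_top"
      using assms by (intro filterlim_tendsto_pos_mult_at_top[OF tendsto_const] filterlim_pow_at_top filterlim_ident) auto
    then have "((\<lambda>y. exp (- (1 / (2 * v) * y\<^sup>2))) \<longlongrightarrow> 0) at_top"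
      by (intro filterlim_compose[OF exp_at_bot] filterlim_compose[OF filterlim_uminus_at_bot_at_top])
    then have "((\<lambda>y. - (c * inverse y * exp (- (1 / (2 * v) * y\<^sup>2)))) \<longlongrightarrow> - (c * 0 * 0)) at_top"
      by (intro tendsto_intros tendsto_inverse_0_at_top filterlim_ident)
    then show "(?F \<longlongrightarrow> 0) at_top" by (simp flip: divide_inverse)
  qed measurable
  moreover have "0 - ?F x = sqrt v / (x * sqrt (2 * pi)) * exp (- (x\<^sup>2 / (2 * v)))"
    by (simp add: c_def mult.commute)
  ultimately show ?thesis by (simp only:)
qed

lemma centred_normal_tail_mills:
  assumes X: "centred_normal X v" and "0 < v" "0 < x"
  defines "m \<equiv> sqrt v / (x * sqrt (2 * pi)) * exp (- (x\<^sup>2 / (2 * v)))"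
  shows "prob {\<omega>\<in>space M. X \<omega> > x} \<le> m" "m / (1 + v / x\<^sup>2) \<le> prob {\<omega>\<in>space M. X \<omega> > x}"
proof -
  let ?d = "normal_density 0 (sqrt v)"
  let ?p = "prob {\<omega>\<in>space M. X \<omega> > x}"
  have m0: "0 \<le> m" using assms by (simp add: m_def)
  have int: "ennreal m = (\<integral>\<^sup>+y. ennreal ((1 + v / y\<^sup>2) * ?d y) * indicator {x..} y \<partial>lborel)"
    using gaussian_mills_integral[OF assms(2,3)] by (simp add: m_def)
  have p: "ennreal ?p = (\<integral>\<^sup>+y. ennreal (?d y) * indicator {x<..} y \<partial>lborel)"
    by (rule centred_normal_tail_eq[OF X assms(2)])
  have "ennreal ?p \<le> ennreal m"
    unfolding p int
  proof (intro nn_integral_mono)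
    fix y :: real
    have "1 * ?d y \<le> (1 + v / y\<^sup>2) * ?d y"
      using assms by (intro mult_right_mono) auto
    then show "ennreal (?d y) * indicator {x<..} y \<le> ennreal ((1 + v / y\<^sup>2) * ?d y) * indicator {x..} y"
      by (auto simp: indicator_def intro!: ennreal_leI)
  qed
  then show "?p \<le> m" using m0 by simp
  have "ennreal m = (\<integral>\<^sup>+y. ennreal ((1 + v / y\<^sup>2) * ?d y) * indicator {x<..} y \<partial>lborel)"
    unfolding int
    by (intro nn_integral_cong_AE, rule AE_mp[OF AE_lborel_singleton[of x]]) (auto simp: indicator_def)
  also have "\<dots> \<le> (\<integral>\<^sup>+y. ennreal (1 + v / x\<^sup>2) * (ennreal (?d y) * indicator {x<..} y) \<partial>lborel)"
  proof (intro nn_integral_mono)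
    fix y :: real
    have "(1 + v / y\<^sup>2) * ?d y \<le> (1 + v / x\<^sup>2) * ?d y" if "x < y"
      using that assms by (intro mult_right_mono add_left_mono divide_left_mono power_mono) auto
    then show "ennreal ((1 + v / y\<^sup>2) * ?d y) * indicator {x<..} y
      \<le> ennreal (1 + v / x\<^sup>2) * (ennreal (?d y) * indicator {x<..} y)"
      using assms by (auto simp: indicator_def ennreal_mult'[symmetric] simp del: ennreal_plus intro!: ennreal_leI)
  qed
  also have "\<dots> = ennreal (1 + v / x\<^sup>2) * ennreal ?p"
    unfolding p by (subst nn_integral_cmult) auto
  also have "\<dots> = ennreal ((1 + v / x\<^sup>2) * ?p)"
    using assms by (subst ennreal_mult) auto
  finally have "m \<le> (1 + v / x\<^sup>2) * ?p"
    using assms by (simp add: ennreal_le_iff)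
  moreover have "0 < 1 + v / x\<^sup>2" using assms by (simp add: add_pos_nonneg)
  ultimately show "m / (1 + v / x\<^sup>2) \<le> ?p"
    by (simp add: pos_divide_le_eq mult.commute)
qed

end

section \<open>The reflection principle for walks with independent steps\<close>

context prob_space
begin

text \<open>
  Whether the walk first passes \<open>u\<close> at time \<open>k\<close> is determined by the steps before \<open>k\<close>, hence independent of
  the later ones. With \<open>D\<close> above \<open>u\<close> this plays the role of the strong Markov property; an upper end of
  \<open>D\<close> limits the overshoot.
\<close>

lemma first_passage_indep_future:
  fixes X :: "nat \<Rightarrow> 'a \<Rightarrow> real"
  assumes ind: "indep_vars (\<lambda>_. borel) X {m..<n}" and k: "m \<le> k" "k \<le> n"
    and B [measurable]: "B \<in> sets borel" and D [measurable]: "D \<in> sets borel"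
  defines "S \<equiv> \<lambda>j \<omega>. \<Sum>l\<in>{m..<j}. X l \<omega>"
  shows "prob {\<omega>\<in>space M. ((\<forall>j\<in>{m..<k}. S j \<omega> \<le> u) \<and> S k \<omega> \<in> D) \<and> (\<Sum>l\<in>{k..<n}. X l \<omega>) \<in> B} =
    prob {\<omega>\<in>space M. (\<forall>j\<in>{m..<k}. S j \<omega> \<le> u) \<and> S k \<omega> \<in> D} * prob {\<omega>\<in>space M. (\<Sum>l\<in>{k..<n}. X l \<omega>) \<in> B}"
proof -
  let ?P = "\<Pi>\<^sub>M l\<in>{m..<k}. (borel :: real measure)" and ?F = "\<Pi>\<^sub>M l\<in>{k..<n}. (borel :: real measure)"
  let ?p = "\<lambda>\<omega>. restrict (\<lambda>l. X l \<omega>) {m..<k}" and ?f = "\<lambda>\<omega>. restrict (\<lambda>l. X l \<omega>) {k..<n}"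
  have "indep_var ?P ?p ?F ?f"
    using k by (intro indep_var_restrict[OF ind]) auto
  note iv = indep_varD[OF this]
  let ?A = "{x\<in>space ?P. (\<forall>j\<in>{m..<k}. (\<Sum>l\<in>{m..<j}. x l) \<le> u) \<and> (\<Sum>l\<in>{m..<k}. x l) \<in> D}"
  let ?B = "{x\<in>space ?F. (\<Sum>l\<in>{k..<n}. x l) \<in> B}"
  have A1: "(\<lambda>x. \<Sum>l\<in>{m..<j}. x l) \<in> borel_measurable ?P" if "j \<le> k" for j
    using that by (intro borel_measurable_sum measurable_component_singleton) auto
  have B1: "(\<lambda>x. \<Sum>l\<in>{k..<n}. x l) \<in> borel_measurable ?F"
    by (intro borel_measurable_sum measurable_component_singleton) auto
  have A: "?A \<in> sets ?P"
  proof -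
    have eqA: "?A = {x\<in>space ?P. \<forall>j\<in>{m..<k}. (\<Sum>l\<in>{m..<j}. x l) \<le> u} \<inter> {x\<in>space ?P. (\<Sum>l\<in>{m..<k}. x l) \<in> D}"
      by auto
    have "{x\<in>space ?P. \<forall>j\<in>{m..<k}. (\<Sum>l\<in>{m..<j}. x l) \<le> u} \<in> sets ?P"
      using A1 by (intro sets.sets_Collect_finite_All borel_measurable_le) auto
    moreover have "{x\<in>space ?P. (\<Sum>l\<in>{m..<k}. x l) \<in> D} \<in> sets ?P"
      using measurable_sets[OF A1[OF order_refl] D] by (simp add: vimage_def Int_def conj_commute)
    ultimately show ?thesis unfolding eqA by (rule sets.Int)
  qed
  have B': "?B \<in> sets ?F"
    using measurable_sets[OF B1 B] by (simp add: vimage_def Int_def conj_commute)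
  have s: "(\<Sum>l\<in>{m..<j}. ?p \<omega> l) = S j \<omega>" if "j \<le> k" for j \<omega>
    unfolding S_def using that by (intro sum.cong) auto
  have f: "(\<Sum>l\<in>{k..<n}. ?f \<omega> l) = (\<Sum>l\<in>{k..<n}. X l \<omega>)" for \<omega>
    by (intro sum.cong) auto
  have inA: "?p \<omega> \<in> ?A \<longleftrightarrow> (\<forall>j\<in>{m..<k}. S j \<omega> \<le> u) \<and> S k \<omega> \<in> D" for \<omega>
    using s by (auto simp: space_PiM simp del: restrict_apply)
  have inB: "?f \<omega> \<in> ?B \<longleftrightarrow> (\<Sum>l\<in>{k..<n}. X l \<omega>) \<in> B" for \<omega>
    using f by (auto simp: space_PiM simp del: restrict_apply)
  have "(\<lambda>x. (?p x, ?f x)) -` (?A \<times> ?B) \<inter> space M =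
      {\<omega>\<in>space M. ((\<forall>j\<in>{m..<k}. S j \<omega> \<le> u) \<and> S k \<omega> \<in> D) \<and> (\<Sum>l\<in>{k..<n}. X l \<omega>) \<in> B}"
    using inA inB by blast
  moreover have "?p -` ?A \<inter> space M = {\<omega>\<in>space M. (\<forall>j\<in>{m..<k}. S j \<omega> \<le> u) \<and> S k \<omega> \<in> D}"
    using inA by blast
  moreover have "?f -` ?B \<inter> space M = {\<omega>\<in>space M. (\<Sum>l\<in>{k..<n}. X l \<omega>) \<in> B}"
    using inB by blast
  ultimately show ?thesis using iv[OF A B'] by simp
qed

context
  fixes X :: "nat \<Rightarrow> 'a \<Rightarrow> real" and v :: "nat \<Rightarrow> real" and m n :: nat
  assumes mn: "m \<le> n"
    and ind: "indep_vars (\<lambda>_. borel) X {m..<n}"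
    and normal: "\<And>k. m \<le> k \<Longrightarrow> k \<le> n \<Longrightarrow> centred_normal (\<lambda>\<omega>. \<Sum>l\<in>{k..<n}. X l \<omega>) (v k)"
begin

private definition "S k \<omega> = (\<Sum>l\<in>{m..<k}. X l \<omega>)"

private lemma S_future: "k \<in> {m..n} \<Longrightarrow> S n \<omega> = S k \<omega> + (\<Sum>l\<in>{k..<n}. X l \<omega>)"
  unfolding S_def by (subst sum.atLeastLessThan_concat) auto

private lemma X_meas [measurable]: "l \<in> {m..<n} \<Longrightarrow> random_variable borel (X l)"
  using ind by (auto simp: indep_vars_def)

private lemma S_meas: "k \<le> n \<Longrightarrow> random_variable borel (S k)"
  unfolding S_def by (intro borel_measurable_sum X_meas) auto

private lemma passage_event:
  assumes "k \<in> {m..n}" "D \<in> sets borel" "B \<in> sets borel"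
  shows "{\<omega>\<in>space M. ((\<forall>j\<in>{m..<k}. S j \<omega> \<le> u) \<and> S k \<omega> \<in> D) \<and> (\<Sum>l\<in>{k..<n}. X l \<omega>) \<in> B} \<in> events"
proof -
  have "random_variable borel (\<lambda>\<omega>. \<Sum>l\<in>{k..<n}. X l \<omega>)"
    using assms by (intro borel_measurable_sum X_meas) auto
  from measurable_sets[OF this assms(3)]
  have 1: "{\<omega>\<in>space M. (\<Sum>l\<in>{k..<n}. X l \<omega>) \<in> B} \<in> events"
    by (simp add: vimage_def Int_def conj_commute)
  have "random_variable borel (S k)" using assms by (intro S_meas) auto
  from measurable_sets[OF this assms(2)]
  have 2: "{\<omega>\<in>space M. S k \<omega> \<in> D} \<in> events"
    by (simp add: vimage_def Int_def conj_commute)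
  have 3: "{\<omega>\<in>space M. \<forall>j\<in>{m..<k}. S j \<omega> \<le> u} \<in> events"
    using assms by (intro sets.sets_Collect_finite_All borel_measurable_le S_meas) auto
  show ?thesis by (intro sets.sets_Collect_conj 1 2 3)
qed

private lemma first_passage:
  assumes "k \<in> {m..n}" "S k \<omega> > u"
  obtains i where "i \<in> {m..k}" "\<forall>j\<in>{m..<i}. S j \<omega> \<le> u" "S i \<omega> > u"
proof -
  define i where "i = (LEAST i. m \<le> i \<and> S i \<omega> > u)"
  have i: "m \<le> i \<and> S i \<omega> > u" unfolding i_def by (rule LeastI[of _ k]) (use assms in auto)
  have "i \<le> k" unfolding i_def using assms by (intro Least_le) auto
  moreover have "S j \<omega> \<le> u" if "j \<in> {m..<i}" for j
    using not_less_Least[of j "\<lambda>i. m \<le> i \<and> S i \<omega> > u"] that by (auto simp: i_def[symmetric])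
  ultimately show ?thesis using that i by auto
qed

private lemma passage_disjoint:
  "disjoint_family_on (\<lambda>k. {\<omega>\<in>space M. ((\<forall>j\<in>{m..<k}. S j \<omega> \<le> u) \<and> S k \<omega> \<in> D) \<and> R k \<omega>}) {m..n}"
  if "D \<subseteq> {u<..}"
proof -
  have "\<not> (S k \<omega> \<in> D \<and> S k \<omega> \<le> u)" for k \<omega> using that by auto
  then show ?thesis
    unfolding disjoint_family_on_def
    by (auto simp: disjoint_iff) (metis atLeastLessThan_iff linorder_neqE_nat)
qed

private lemma walk_max_event: "{\<omega>\<in>space M. \<exists>k\<in>{m..n}. S k \<omega> > u} \<in> events"
  by (intro sets.sets_Collect_finite_Ex borel_measurable_less S_meas) auto

text \<open>
  After its first passage above \<open>u\<close> the walk moves by an independent symmetric amount, so with conditional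
  probability at least 1/2 it does not end lower than it was at the passage.
\<close>

lemma levy_maximal_inequality:
  "prob {\<omega>\<in>space M. \<exists>k\<in>{m..n}. (\<Sum>l\<in>{m..<k}. X l \<omega>) > u}
    \<le> 2 * prob {\<omega>\<in>space M. (\<Sum>l\<in>{m..<n}. X l \<omega>) > u}"
proof -
  let ?C = "\<lambda>k B. {\<omega>\<in>space M. ((\<forall>j\<in>{m..<k}. S j \<omega> \<le> u) \<and> S k \<omega> \<in> {u<..}) \<and> (\<Sum>l\<in>{k..<n}. X l \<omega>) \<in> B}"
  have C: "?C k B \<in> events" if "k \<in> {m..n}" "B \<in> sets borel" for k B
    using that by (intro passage_event) auto
  have half: "prob (?C k UNIV) \<le> 2 * prob (?C k {0..})" if k: "k \<in> {m..n}" for k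
  proof -
    have "1 / 2 \<le> prob {\<omega>\<in>space M. (\<Sum>l\<in>{k..<n}. X l \<omega>) \<in> {0..}}"
      using centred_normal_nonneg_ge_half[OF normal[of k]] k by simp
    then have "prob (?C k UNIV) * (1 / 2) \<le> prob (?C k UNIV) * prob {\<omega>\<in>space M. (\<Sum>l\<in>{k..<n}. X l \<omega>) \<in> {0..}}"
      by (intro mult_left_mono) auto
    also have "\<dots> = prob (?C k {0..})"
      using first_passage_indep_future[OF ind, of k "{0..}" "{u<..}" u] k by (simp add: S_def)
    finally show ?thesis by simp
  qed
  have "prob {\<omega>\<in>space M. \<exists>k\<in>{m..n}. S k \<omega> > u} \<le> prob (\<Union>k\<in>{m..n}. ?C k UNIV)"
  proof (intro finite_measure_mono)
    show "(\<Union>k\<in>{m..n}. ?C k UNIV) \<in> events" by (intro sets.finite_UN passage_event) auto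
    show "{\<omega>\<in>space M. \<exists>k\<in>{m..n}. S k \<omega> > u} \<subseteq> (\<Union>k\<in>{m..n}. ?C k UNIV)"
    proof safe
      fix \<omega> k assume "\<omega> \<in> space M" "k \<in> {m..n}" "u < S k \<omega>"
      then obtain i where "i \<in> {m..k}" "\<forall>j\<in>{m..<i}. S j \<omega> \<le> u" "S i \<omega> > u"
        using first_passage by metis
      then show "\<omega> \<in> (\<Union>k\<in>{m..n}. ?C k UNIV)" using \<open>k \<in> {m..n}\<close> \<open>\<omega> \<in> space M\<close> by force
    qed
  qed
  also have "\<dots> \<le> (\<Sum>k\<in>{m..n}. prob (?C k UNIV))"
    by (intro finite_measure_subadditive_finite image_subsetI C) simp_all
  also have "\<dots> \<le> (\<Sum>k\<in>{m..n}. 2 * prob (?C k {0..}))" by (intro sum_mono half)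
  also have "\<dots> = 2 * prob (\<Union>k\<in>{m..n}. ?C k {0..})"
    unfolding sum_distrib_left[symmetric]
    by (intro arg_cong[where f="\<lambda>x. 2 * x"] finite_measure_finite_Union[symmetric] image_subsetI C passage_disjoint) (simp_all add: subset_iff)
  also have "prob (\<Union>k\<in>{m..n}. ?C k {0..}) \<le> prob {\<omega>\<in>space M. S n \<omega> > u}"
    using S_meas[of n] by (intro finite_measure_mono) (auto simp: S_future)
  finally show ?thesis by (simp add: S_def)
qed

text \<open>
  Unless some step exceeds \<open>\<epsilon>\<close>, the walk overshoots \<open>u\<close> by at most \<open>\<epsilon>\<close> at its first passage. If it then
  ends above \<open>u + 2 * \<epsilon>\<close>, it has risen by more than \<open>\<epsilon>\<close> since; falling by more than \<open>\<epsilon>\<close> instead has the same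
  probability and leads to a walk that has passed \<open>u\<close> but ends below \<open>u\<close>. These two ways of
  passing \<open>u\<close> are disjoint.
\<close>

lemma reflection_lower_bound:
  assumes "0 \<le> u" "0 < \<epsilon>"
  shows "2 * prob {\<omega>\<in>space M. (\<Sum>l\<in>{m..<n}. X l \<omega>) > u + 2 * \<epsilon>}
    \<le> prob {\<omega>\<in>space M. \<exists>k\<in>{m..n}. (\<Sum>l\<in>{m..<k}. X l \<omega>) > u} + (\<Sum>l\<in>{m..<n}. prob {\<omega>\<in>space M. X l \<omega> > \<epsilon>})"
proof -
  let ?C = "\<lambda>k B. {\<omega>\<in>space M. ((\<forall>j\<in>{m..<k}. S j \<omega> \<le> u) \<and> S k \<omega> \<in> {u<..u+\<epsilon>}) \<and> (\<Sum>l\<in>{k..<n}. X l \<omega>) \<in> B}"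
  let ?N = "\<lambda>l. {\<omega>\<in>space M. X l \<omega> > \<epsilon>}"
  let ?E = "{\<omega>\<in>space M. S n \<omega> > u + 2 * \<epsilon>}"
  let ?G = "{\<omega>\<in>space M. \<exists>k\<in>{m..n}. S k \<omega> > u}"
  have N: "?N l \<in> events" if "l \<in> {m..<n}" for l
    using X_meas[OF that] by simp
  have E: "?E \<in> events" using S_meas[of n] by simp
  have C: "?C k B \<in> events" if "k \<in> {m..n}" "B \<in> sets borel" for k B
    using that by (intro passage_event) auto
  have UC: "(\<Union>k\<in>{m..n}. ?C k B) \<in> events" if "B \<in> sets borel" for B
    using that by (intro sets.finite_UN C) auto
  \<comment> \<open>the reflection of the path after its first passage\<close>
  have flip: "prob (?C k {\<epsilon><..}) = prob (?C k {..<-\<epsilon>})" if k: "k \<in> {m..n}" for k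
  proof -
    have "prob {\<omega>\<in>space M. (\<Sum>l\<in>{k..<n}. X l \<omega>) \<in> {\<epsilon><..}} = prob {\<omega>\<in>space M. (\<Sum>l\<in>{k..<n}. X l \<omega>) \<in> {..<-\<epsilon>}}"
      using centred_normal_symmetric[OF normal[of k], of \<epsilon>] k by simp
    then show ?thesis
      using first_passage_indep_future[OF ind, of k "{\<epsilon><..}" "{u<..u+\<epsilon>}" u]
        first_passage_indep_future[OF ind, of k "{..<-\<epsilon>}" "{u<..u+\<epsilon>}" u] k
      by (simp add: S_def)
  qed
  have "?E \<subseteq> (\<Union>l\<in>{m..<n}. ?N l) \<union> (\<Union>k\<in>{m..n}. ?C k {\<epsilon><..})"
  proof
    fix \<omega> assume "\<omega> \<in> ?E"
    then have \<omega>: "\<omega> \<in> space M" "S n \<omega> > u + 2 * \<epsilon>" by auto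
    then obtain i where i: "i \<in> {m..n}" "\<forall>j\<in>{m..<i}. S j \<omega> \<le> u" "S i \<omega> > u"
      using first_passage[of n u \<omega>] mn assms by auto
    show "\<omega> \<in> (\<Union>l\<in>{m..<n}. ?N l) \<union> (\<Union>k\<in>{m..n}. ?C k {\<epsilon><..})"
    proof (cases "\<omega> \<in> (\<Union>l\<in>{m..<n}. ?N l)")
      case False
      have "i \<noteq> m" using i assms by (auto simp: S_def)
      then obtain l where l: "i = Suc l" "l \<in> {m..<n}" using i by (cases i) auto
      then have "S i \<omega> = S l \<omega> + X l \<omega>" by (simp add: S_def)
      moreover have "\<not> X l \<omega> > \<epsilon>" using False l(2) \<omega>(1) by blast
      moreover have "S l \<omega> \<le> u" using i(2) l by simp
      ultimately have "S i \<omega> \<le> u + \<epsilon>" by linarith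
      then have "\<omega> \<in> ?C i {\<epsilon><..}"
        using i \<omega> S_future[OF i(1), of \<omega>] by auto
      then show ?thesis using i by blast
    qed blast
  qed
  then have "prob ?E \<le> prob ((\<Union>l\<in>{m..<n}. ?N l) \<union> (\<Union>k\<in>{m..n}. ?C k {\<epsilon><..}))"
    using N by (intro finite_measure_mono sets.Un UC) auto
  also have "\<dots> \<le> prob (\<Union>l\<in>{m..<n}. ?N l) + prob (\<Union>k\<in>{m..n}. ?C k {\<epsilon><..})"
    using N by (intro measure_Un_le UC) auto
  also have "prob (\<Union>l\<in>{m..<n}. ?N l) \<le> (\<Sum>l\<in>{m..<n}. prob (?N l))"
    using N by (intro finite_measure_subadditive_finite) auto
  also have "prob (\<Union>k\<in>{m..n}. ?C k {\<epsilon><..}) \<le> (\<Sum>k\<in>{m..n}. prob (?C k {\<epsilon><..}))"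
    by (intro finite_measure_subadditive_finite image_subsetI C) simp_all
  also have "\<dots> = (\<Sum>k\<in>{m..n}. prob (?C k {..<-\<epsilon>}))" by (intro sum.cong flip refl)
  also have "\<dots> = prob (\<Union>k\<in>{m..n}. ?C k {..<-\<epsilon>})"
    by (intro finite_measure_finite_Union[symmetric] image_subsetI C passage_disjoint) (simp_all add: subset_iff)
  finally have 1: "prob ?E \<le> (\<Sum>l\<in>{m..<n}. prob (?N l)) + prob (\<Union>k\<in>{m..n}. ?C k {..<-\<epsilon>})" by simp
  have "?E \<inter> (\<Union>k\<in>{m..n}. ?C k {..<-\<epsilon>}) = {}"
    using assms by (auto simp: S_future)
  then have "prob ?E + prob (\<Union>k\<in>{m..n}. ?C k {..<-\<epsilon>}) = prob (?E \<union> (\<Union>k\<in>{m..n}. ?C k {..<-\<epsilon>}))"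
    by (intro finite_measure_Union[symmetric] E UC) simp_all
  also have "\<dots> \<le> prob ?G"
  proof (intro finite_measure_mono walk_max_event Un_least)
    show "?E \<subseteq> ?G" using mn assms by (auto intro!: bexI[of _ n])
  qed auto
  finally show ?thesis using 1 by (simp add: S_def)
qed

end

end

section \<open>Families of independent families\<close>

context prob_space
begin

text \<open>
  Independence between blocks and independence within each block give independence of all entries, provided that
  the entries of a block are functions of the block variable. It is applied twice: the blocks are first the
  coordinates of one stage of the tree and then the stages.
\<close>

lemma indep_vars_nested:
  fixes Y :: "'i \<Rightarrow> 'a \<Rightarrow> 'b" and X :: "'i \<Rightarrow> 'j \<Rightarrow> 'a \<Rightarrow> 'c"
  assumes outer: "indep_vars N Y I"
    and inner: "\<And>i. i \<in> I \<Longrightarrow> indep_vars (\<lambda>_. K) (X i) (J i)"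
    and fm: "\<And>i j. i \<in> I \<Longrightarrow> j \<in> J i \<Longrightarrow> f i j \<in> N i \<rightarrow>\<^sub>M K"
    and f: "\<And>i j \<omega>. i \<in> I \<Longrightarrow> j \<in> J i \<Longrightarrow> \<omega> \<in> space M \<Longrightarrow> f i j (Y i \<omega>) = X i j \<omega>"
  shows "indep_vars (\<lambda>_. K) (\<lambda>(i, j). X i j) (SIGMA i:I. J i)"
  unfolding indep_vars_def2
proof (intro conjI ballI)
  fix x assume "x \<in> (SIGMA i:I. J i)"
  then show "random_variable K (case x of (i, j) \<Rightarrow> X i j)"
    using inner by (auto simp: indep_vars_def)
next
  show "indep_sets (\<lambda>x. {(case x of (i, j) \<Rightarrow> X i j) -` A \<inter> space M |A. A \<in> sets K}) (SIGMA i:I. J i)"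
  proof (rule indep_setsI)
    fix x assume "x \<in> (SIGMA i:I. J i)"
    then show "{(case x of (i, j) \<Rightarrow> X i j) -` A \<inter> space M |A. A \<in> sets K} \<subseteq> events"
      using inner by (auto simp: indep_vars_def intro!: measurable_sets)
  next
    fix A F assume F: "F \<noteq> {}" "F \<subseteq> (SIGMA i:I. J i)" "finite F"
      and "\<forall>x\<in>F. A x \<in> {(case x of (i, j) \<Rightarrow> X i j) -` A \<inter> space M |A. A \<in> sets K}"
    then have "\<forall>x\<in>F. \<exists>B. B \<in> sets K \<and> A x = X (fst x) (snd x) -` B \<inter> space M"
      by (fastforce simp: case_prod_unfold)
    then obtain B where B: "\<And>x. x \<in> F \<Longrightarrow> B x \<in> sets K"
      "\<And>x. x \<in> F \<Longrightarrow> A x = X (fst x) (snd x) -` B x \<inter> space M"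
      by metis
    define I' where "I' = fst ` F"
    define J' where "J' i = {j. (i, j) \<in> F}" for i
    have FS: "F = (SIGMA i:I'. J' i)" by (force simp: I'_def J'_def)
    have J': "finite (J' i)" "J' i \<subseteq> J i" for i
      using F finite_subset[of "J' i" "snd ` F"] by (force simp: J'_def)+
    have I': "finite I'" "I' \<noteq> {}" "I' \<subseteq> I" using F by (auto simp: I'_def)
    have J'ne: "J' i \<noteq> {}" if "i \<in> I'" for i using that by (auto simp: I'_def J'_def)
    define C where "C i = {y \<in> space (N i). \<forall>j\<in>J' i. f i j y \<in> B (i, j)}" for i
    have C: "C i \<in> sets (N i)" if i: "i \<in> I'" for i
    proof -
      have "{y \<in> space (N i). f i j y \<in> B (i, j)} \<in> sets (N i)" if j: "j \<in> J' i" for j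
      proof -
        have "f i j \<in> N i \<rightarrow>\<^sub>M K" using i j I' J' by (intro fm) auto
        from measurable_sets[OF this B(1)[of "(i, j)"]] show ?thesis
          using j by (simp add: J'_def vimage_def Int_def conj_commute)
      qed
      then show ?thesis unfolding C_def using J' by (intro sets.sets_Collect_finite_All) auto
    qed
    have YN: "Y i \<omega> \<in> space (N i)" if "i \<in> I" "\<omega> \<in> space M" for i \<omega>
      using outer that by (auto simp: indep_vars_def dest!: measurable_space)
    have eqC: "Y i -` C i \<inter> space M = (\<Inter>j\<in>J' i. X i j -` B (i, j) \<inter> space M)" if i: "i \<in> I'" for i
    proof -
      have "i \<in> I" using i I' by auto
      then show ?thesis using J'ne[OF i] J'(2)[of i] YN f by (auto simp: C_def subset_iff)
    qed
    have "(\<Inter>x\<in>F. A x) = (\<Inter>i\<in>I'. \<Inter>j\<in>J' i. A (i, j))" by (subst FS) auto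
    also have "\<dots> = (\<Inter>i\<in>I'. Y i -` C i \<inter> space M)"
      using eqC B(2) by (intro INF_cong refl) (auto simp: J'_def)
    finally have "prob (\<Inter>x\<in>F. A x) = prob (\<Inter>i\<in>I'. Y i -` C i \<inter> space M)" by simp
    also have "\<dots> = (\<Prod>i\<in>I'. prob (Y i -` C i \<inter> space M))"
      using I' C by (intro indep_varsD[OF outer]) auto
    also have "\<dots> = (\<Prod>i\<in>I'. \<Prod>j\<in>J' i. prob (X i j -` B (i, j) \<inter> space M))"
    proof (intro prod.cong refl)
      fix i assume i: "i \<in> I'"
      have "prob (\<Inter>j\<in>J' i. X i j -` B (i, j) \<inter> space M) = (\<Prod>j\<in>J' i. prob (X i j -` B (i, j) \<inter> space M))"
        using i I' J' J'ne B(1) by (intro indep_varsD[OF inner[of i]]) (auto simp: J'_def)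
      then show "prob (Y i -` C i \<inter> space M) = (\<Prod>j\<in>J' i. prob (X i j -` B (i, j) \<inter> space M))"
        by (simp add: eqC[OF i])
    qed
    also have "\<dots> = (\<Prod>(i, j)\<in>F. prob (X i j -` B (i, j) \<inter> space M))"
      unfolding FS by (rule prod.Sigma) (use I' J' in auto)
    also have "\<dots> = (\<Prod>x\<in>F. prob (A x))"
      using B(2) by (intro prod.cong) (auto simp: case_prod_unfold)
    finally show "prob (\<Inter>x\<in>F. A x) = (\<Prod>x\<in>F. prob (A x))" .
  qed
qed

lemma indep_vars_reindex:
  assumes ind: "indep_vars N X I" and h: "inj_on h J" "h ` J \<subseteq> I"
  shows "indep_vars (\<lambda>j. N (h j)) (\<lambda>j. X (h j)) J"
  unfolding indep_vars_def2
proof (intro conjI ballI)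
  fix j assume "j \<in> J"
  then show "random_variable (N (h j)) (X (h j))" using ind h by (auto simp: indep_vars_def)
next
  have s: "indep_sets (\<lambda>i. {X i -` A \<inter> space M |A. A \<in> sets (N i)}) I"
    using ind by (simp add: indep_vars_def2)
  show "indep_sets (\<lambda>j. {X (h j) -` A \<inter> space M |A. A \<in> sets (N (h j))}) J"
  proof (rule indep_setsI)
    fix j assume "j \<in> J"
    then show "{X (h j) -` A \<inter> space M |A. A \<in> sets (N (h j))} \<subseteq> events"
      using s h by (auto simp: indep_sets_def)
  next
    fix A F assume F: "F \<noteq> {}" "F \<subseteq> J" "finite F"
      and A: "\<forall>j\<in>F. A j \<in> {X (h j) -` A \<inter> space M |A. A \<in> sets (N (h j))}"
    have inj: "inj_on h F" using h F by (auto intro: inj_on_subset)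
    define A' where "A' = A \<circ> the_inv_into F h"
    have A': "A' (h j) = A j" if "j \<in> F" for j
      using the_inv_into_f_f[OF inj that] by (simp add: A'_def)
    have "prob (\<Inter>i\<in>h ` F. A' i) = (\<Prod>i\<in>h ` F. prob (A' i))"
      using F h A A' by (intro indep_setsD[OF s]) auto
    then show "prob (\<Inter>j\<in>F. A j) = (\<Prod>j\<in>F. prob (A j))"
      using A' inj by (simp add: prod.reindex)
  qed
qed

lemma indep_vars_group_sums:
  fixes Z :: "'i \<Rightarrow> 'j \<Rightarrow> 'a \<Rightarrow> real"
  assumes ind: "indep_vars (\<lambda>_. borel) (\<lambda>(i, j). Z i j) (SIGMA i:I. J i)"
    and fin: "\<And>i. i \<in> I \<Longrightarrow> finite (J i)"
  shows "indep_vars (\<lambda>_. borel) (\<lambda>i \<omega>. \<Sum>j\<in>J i. c i j * Z i j \<omega>) I"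
proof -
  let ?K = "\<lambda>i. {i} \<times> J i"
  have "indep_vars (\<lambda>i. \<Pi>\<^sub>M x\<in>?K i. borel) (\<lambda>i \<omega>. restrict (\<lambda>x. (case x of (i, j) \<Rightarrow> Z i j) \<omega>) (?K i)) I"
    by (rule indep_vars_restrict[OF ind]) (auto simp: disjoint_family_on_def)
  then have "indep_vars (\<lambda>_. borel) (\<lambda>i \<omega>. (\<Sum>j\<in>J i. c i j * restrict (\<lambda>x. (case x of (i, j) \<Rightarrow> Z i j) \<omega>) (?K i) (i, j))) I"
    by (rule indep_vars_compose2[where Y = "\<lambda>i x. \<Sum>j\<in>J i. c i j * x (i, j)"])
      (intro borel_measurable_sum borel_measurable_times measurable_const measurable_component_singleton, auto)
  then show ?thesis
    by (subst (asm) indep_vars_cong[OF refl _ refl, where Y = "\<lambda>i \<omega>. \<Sum>j\<in>J i. c i j * Z i j \<omega>"])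
      (auto intro!: sum.cong)
qed

end

section \<open>The tree as a branching random walk\<close>

locale decision_tree = prob_space M for M :: "'a measure" +
  fixes T :: real and \<eta> :: nat and \<tau> :: "nat \<Rightarrow> real" and N :: "nat \<Rightarrow> nat"
    and W :: "nat \<Rightarrow> nat \<Rightarrow> real \<Rightarrow> 'a \<Rightarrow> real"
  assumes \<eta>: "1 \<le> \<eta>"
    and \<tau>_pos: "0 < \<tau> 1"
    and \<tau>_less: "\<And>i. 1 \<le> i \<Longrightarrow> i < \<eta> \<Longrightarrow> \<tau> i < \<tau> (Suc i)"
    and \<tau>_last: "\<tau> \<eta> < T"
    and N_pos: "\<And>i. 1 \<le> i \<Longrightarrow> i \<le> \<eta> \<Longrightarrow> 1 \<le> N i"
    and driver: "tree_driver M \<eta> N W"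
begin

abbreviation "P \<equiv> offspring_prod N"

text \<open>
  The start of stage \<open>i\<close>. The values \<open>\<tau> 0\<close> and \<open>\<tau> (Suc \<eta>)\<close> are arbitrary, so the conventional
  values 0 and \<open>T\<close> are put in by hand.
\<close>

definition stage_time :: "nat \<Rightarrow> real" where
  "stage_time i = (if i = 0 then 0 else if i \<le> \<eta> then \<tau> i else T)"

lemma stage_time_simps: "stage_time 0 = 0" "stage_time (Suc 0) = \<tau> 1" "stage_time (Suc \<eta>) = T" "stage_time \<eta> = \<tau> \<eta>"
  using \<eta> by (auto simp: stage_time_def)

lemma stage_time_less: "i \<le> \<eta> \<Longrightarrow> stage_time i < stage_time (Suc i)"
  using \<tau>_pos \<tau>_less[of i] \<tau>_last \<eta> by (cases "i = 0"; cases "i = \<eta>") (auto simp: stage_time_def)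

lemma stage_time_mono: "i \<le> j \<Longrightarrow> j \<le> Suc \<eta> \<Longrightarrow> stage_time i \<le> stage_time j"
proof (induction j rule: dec_induct)
  case (step j)
  then show ?case using stage_time_less[of j] by simp
qed simp

lemma stage_time_nonneg: "i \<le> Suc \<eta> \<Longrightarrow> 0 \<le> stage_time i"
  using stage_time_mono[of 0 i] by (simp add: stage_time_simps)

lemma P_0: "P 0 = 1"
  by (simp add: offspring_prod_def)

lemma P_Suc: "P (Suc i) = P i * N (Suc i)"
  by (simp add: offspring_prod_def)

lemma P_pos: "i \<le> \<eta> \<Longrightarrow> 0 < P i"
  using N_pos by (induction i) (auto simp: P_0 P_Suc Suc_le_eq)

lemma P_dvd: "i \<le> j \<Longrightarrow> P i dvd P j"
  by (induction j rule: dec_induct) (auto simp: P_Suc)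

lemma W_BM: "i \<le> \<eta> \<Longrightarrow> k < P i \<Longrightarrow> standard_BM M (W i k)"
  using driver by (auto simp: tree_driver_def standard_vector_BM_def)

lemma W_0: "i \<le> \<eta> \<Longrightarrow> k < P i \<Longrightarrow> \<omega> \<in> space M \<Longrightarrow> W i k 0 \<omega> = 0"
  using W_BM[of i k] by (auto simp: standard_BM_def)

lemma tree_stage_eq:
  assumes "i \<le> \<eta>" "stage_time i < t \<or> i = 0" "t \<le> stage_time (Suc i)"
  shows "tree_stage \<eta> \<tau> t = i"
proof (cases "i = 0")
  case True
  then show ?thesis using assms \<eta> by (simp add: tree_stage_def stage_time_def)
next
  case False
  have "\<tau> 1 \<le> stage_time i" using stage_time_mono[of 1 i] assms False by (simp add: stage_time_simps)
  then have "\<not> t \<le> \<tau> 1" using assms False by auto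
  moreover have "Max {j \<in> {1..\<eta>}. \<tau> j < t} = i"
  proof (rule Max_eqI)
    show "i \<in> {j \<in> {1..\<eta>}. \<tau> j < t}" using assms False by (auto simp: stage_time_def)
  next
    fix j assume j: "j \<in> {j \<in> {1..\<eta>}. \<tau> j < t}"
    show "j \<le> i"
    proof (rule ccontr)
      assume "\<not> j \<le> i"
      then have "stage_time (Suc i) \<le> stage_time j" using j by (intro stage_time_mono) auto
      also have "stage_time j = \<tau> j" using j by (auto simp: stage_time_def)
      finally show False using j assms by auto
    qed
  qed auto
  ultimately show ?thesis by (simp add: tree_stage_def)
qed

text \<open>
  Except for the first one, the stage intervals of the tree are open on the left. At the left end the driving motion of the stage is
  0 and the stacked copies agree with the previous stage, so the formula of the stage extends to the
  closed interval.
\<close>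

lemma tree_branch_in_stage:
  assumes i: "i \<le> \<eta>" and t: "stage_time i \<le> t" "t \<le> stage_time (Suc i)" and \<omega>: "\<omega> \<in> space M"
  shows "tree_branch \<eta> N \<tau> W \<gamma> t \<omega> = tree_segment N \<tau> W i (\<gamma> mod P i) t \<omega>"
proof (cases "stage_time i < t \<or> i = 0")
  case True
  then show ?thesis using tree_stage_eq[OF i True t(2)] by (simp add: tree_branch_def)
next
  case False
  then obtain j where j: "i = Suc j" "t = stage_time i" using t by (cases i) auto
  have "tree_stage \<eta> \<tau> t = j"
    using i j stage_time_less[of j] by (intro tree_stage_eq) auto
  moreover have "\<tau> (Suc j) = t" using i j by (simp add: stage_time_def)
  moreover have "W (Suc j) (\<gamma> mod P (Suc j)) 0 \<omega> = 0"
    using i j \<omega> P_pos[of i] by (intro W_0) auto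
  moreover have "\<gamma> mod P (Suc j) mod P j = \<gamma> mod P j"
    using P_dvd[of j "Suc j"] by (simp add: mod_mod_cancel)
  ultimately show ?thesis by (simp add: tree_branch_def j)
qed

lemma tree_segment_diff:
  assumes "i \<le> \<eta>"
  shows "tree_segment N \<tau> W i k t' \<omega> - tree_segment N \<tau> W i k t \<omega> = W i k (t' - stage_time i) \<omega> - W i k (t - stage_time i) \<omega>"
  using assms by (cases i) (auto simp: stage_time_def)

text \<open>
  Each stage is divided into \<open>n\<close> equal pieces, and the grid points are numbered through all stages. The piece from
  point \<open>l\<close> to point \<open>Suc l\<close> lies in stage \<open>l div n\<close>.
\<close>

definition grid :: "nat \<Rightarrow> nat \<Rightarrow> real" where
  "grid n l = stage_time (l div n) + (stage_time (Suc (l div n)) - stage_time (l div n)) * real (l mod n) / real n"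

definition grid_step :: "nat \<Rightarrow> nat \<Rightarrow> real" where
  "grid_step n l = (stage_time (Suc (l div n)) - stage_time (l div n)) / real n"

lemma grid_stage:
  assumes "0 < n" "m \<le> n"
  shows "grid n (i * n + m) = stage_time i + (stage_time (Suc i) - stage_time i) * real m / real n"
proof (cases "m = n")
  case True
  have "i * n + n = Suc i * n" by simp
  then have "(i * n + n) div n = Suc i" "(i * n + n) mod n = 0"
    using assms by (metis nonzero_mult_div_cancel_right less_numeral_extra(3), metis mod_mult_self2_is_0)
  then show ?thesis using assms True by (simp add: grid_def)
next
  case False
  then show ?thesis using assms by (simp add: grid_def)
qed

lemma grid_multiple: "0 < n \<Longrightarrow> grid n (i * n) = stage_time i"
  using grid_stage[of n 0 i] by simp

lemma grid_Suc:
  assumes "0 < n"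
  shows "grid n (Suc l) = stage_time (l div n) + (stage_time (Suc (l div n)) - stage_time (l div n)) * real (Suc (l mod n)) / real n"
proof -
  have "Suc l = (l div n) * n + Suc (l mod n)" by simp
  then show ?thesis
    using grid_stage[OF assms, of "Suc (l mod n)" "l div n"] assms by (metis Suc_leI mod_less_divisor)
qed

lemma grid_Suc_diff: "0 < n \<Longrightarrow> grid n (Suc l) - grid n l = grid_step n l"
  by (subst grid_Suc, assumption, simp add: grid_def[of n l] grid_step_def add_divide_distrib distrib_left)

lemma sum_grid_step: "0 < n \<Longrightarrow> a \<le> b \<Longrightarrow> (\<Sum>l\<in>{a..<b}. grid_step n l) = grid n b - grid n a"
  using sum_Suc_diff'[of a b "grid n"] by (simp add: grid_Suc_diff)

lemma stage_le: "0 < n \<Longrightarrow> l < Suc \<eta> * n \<Longrightarrow> l div n \<le> \<eta>"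
  using less_mult_imp_div_less[of l "Suc \<eta>" n] by (simp del: mult_Suc)

lemma grid_step_pos: "0 < n \<Longrightarrow> l < Suc \<eta> * n \<Longrightarrow> 0 < grid_step n l"
  using stage_time_less[OF stage_le[of n l]] by (simp add: grid_step_def)

lemma grid_step_le:
  assumes "0 < n" "l < Suc \<eta> * n"
  shows "grid_step n l \<le> T / real n"
proof -
  have "stage_time (Suc (l div n)) \<le> T" "0 \<le> stage_time (l div n)"
    using stage_le[OF assms] stage_time_mono[of "Suc (l div n)" "Suc \<eta>"] stage_time_nonneg[of "l div n"] by (auto simp: stage_time_simps)
  then show ?thesis using assms by (simp add: grid_step_def divide_right_mono)
qed

lemma grid_mono:
  assumes "a \<le> b" "0 < n" "b \<le> Suc \<eta> * n"
  shows "grid n a \<le> grid n b"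
  using assms
proof (induction b rule: dec_induct)
  case (step b)
  then show ?case using grid_Suc_diff[of n b] grid_step_pos[of n b] by simp
qed simp

lemma grid_in_stage:
  assumes "0 < n" "l < Suc \<eta> * n"
  shows "stage_time (l div n) \<le> grid n l" "grid n l \<le> grid n (Suc l)" "grid n (Suc l) \<le> stage_time (Suc (l div n))"
proof -
  have pos: "0 < stage_time (Suc (l div n)) - stage_time (l div n)" using stage_time_less[OF stage_le[OF assms]] by simp
  then show "stage_time (l div n) \<le> grid n l" by (simp add: grid_def)
  show "grid n l \<le> grid n (Suc l)" using grid_mono[of l "Suc l" n] assms by simp
  have "real (Suc (l mod n)) \<le> real n" using assms(1) by (metis Suc_leI mod_less_divisor of_nat_mono)
  then have "(stage_time (Suc (l div n)) - stage_time (l div n)) * (real (Suc (l mod n)) / real n) \<le> (stage_time (Suc (l div n)) - stage_time (l div n)) * 1"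
    using pos assms by (intro mult_left_mono) auto
  then show "grid n (Suc l) \<le> stage_time (Suc (l div n))"
    using grid_Suc[OF assms(1), of l] by simp
qed

definition coord_step :: "nat \<Rightarrow> nat \<Rightarrow> nat \<Rightarrow> 'a \<Rightarrow> real" where
  "coord_step n l k \<omega> = W (l div n) k (grid n (Suc l) - stage_time (l div n)) \<omega> - W (l div n) k (grid n l - stage_time (l div n)) \<omega>"

text \<open>
  Along the grid every branch is a sum of steps, and over one grid piece two branches share the step
  exactly if they are at the same coordinate in that stage: the tree is a branching random walk.
\<close>

lemma tree_branch_grid:
  assumes n: "0 < n" and \<omega>: "\<omega> \<in> space M" and "l \<le> Suc \<eta> * n"
  shows "tree_branch \<eta> N \<tau> W \<gamma> (grid n l) \<omega> = (\<Sum>l'<l. coord_step n l' (\<gamma> mod P (l' div n)) \<omega>)"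
  using assms(3)
proof (induction l)
  case 0
  have "tree_branch \<eta> N \<tau> W \<gamma> 0 \<omega> = tree_segment N \<tau> W 0 (\<gamma> mod P 0) 0 \<omega>"
    using \<omega> stage_time_less[of 0] by (intro tree_branch_in_stage) (auto simp: stage_time_simps)
  then show ?case using W_0[of 0 0 \<omega>] \<omega> by (simp add: grid_def stage_time_simps P_0)
next
  case (Suc l)
  let ?i = "l div n"
  have l: "l < Suc \<eta> * n" using Suc.prems by simp
  note g = grid_in_stage[OF n l] and i = stage_le[OF n l]
  have "tree_branch \<eta> N \<tau> W \<gamma> (grid n (Suc l)) \<omega> - tree_branch \<eta> N \<tau> W \<gamma> (grid n l) \<omega>
     = tree_segment N \<tau> W ?i (\<gamma> mod P ?i) (grid n (Suc l)) \<omega> - tree_segment N \<tau> W ?i (\<gamma> mod P ?i) (grid n l) \<omega>"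
    using g i \<omega> by (subst (1 2) tree_branch_in_stage[of ?i]) auto
  also have "\<dots> = coord_step n l (\<gamma> mod P ?i) \<omega>"
    using tree_segment_diff[OF i] by (simp add: coord_step_def)
  finally show ?case using Suc by simp
qed

lemma coord_step_normal:
  assumes "0 < n" "l < Suc \<eta> * n" "k < P (l div n)"
  shows "centred_normal (coord_step n l k) (grid_step n l)"
proof -
  have bm: "standard_BM M (W (l div n) k)"
    using assms by (intro W_BM stage_le)
  let ?a = "grid n l - stage_time (l div n)" and ?b = "grid n (Suc l) - stage_time (l div n)"
  have ab: "0 \<le> ?a" "?a < ?b"
    using grid_in_stage[OF assms(1,2)] grid_Suc_diff[OF assms(1), of l] grid_step_pos[OF assms(1,2)] by auto
  have "distributed M lborel (\<lambda>\<omega>. W (l div n) k ?b \<omega> - W (l div n) k ?a \<omega>) (\<lambda>x. ennreal (normal_density 0 (sqrt (?b - ?a)) x))"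
    using bm ab unfolding standard_BM_def by blast
  moreover have "?b - ?a = grid_step n l" using grid_Suc_diff[OF assms(1), of l] by simp
  ultimately have "distributed M lborel (coord_step n l k) (\<lambda>x. ennreal (normal_density 0 (sqrt (grid_step n l)) x))"
    by (simp only: coord_step_def[abs_def])
  then show ?thesis
    using grid_step_pos[OF assms(1,2)] distributed_measurable[of M lborel "coord_step n l k"]
    by (auto simp: centred_normal_def)
qed

lemma coord_step_indep:
  assumes n: "0 < n"
  shows "indep_vars (\<lambda>_. borel) (\<lambda>(l, k). coord_step n l k) (SIGMA l:{..<Suc \<eta> * n}. {..<P (l div n)})"
proof -
  define u where "u i m = (stage_time (Suc i) - stage_time i) * real m / real n" for i m
  define X where "X i = (\<lambda>(k, m) \<omega>. W i k (u i (Suc m)) \<omega> - W i k (u i m) \<omega>)" for i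
  have u0: "0 \<le> u i m" if "i \<le> \<eta>" for i m
    using stage_time_less[OF that] by (simp add: u_def)
  have stage: "indep_vars (\<lambda>_. borel) (X i) (SIGMA k:{..<P i}. {..<n})" if i: "i \<le> \<eta>" for i
    unfolding X_def
  proof (rule indep_vars_nested[where Y = "\<lambda>k \<omega>. \<lambda>t\<in>{0..}. W i k t \<omega>" and N = "\<lambda>_. \<Pi>\<^sub>M t\<in>{0..}. borel"
        and f = "\<lambda>k m y. y (u i (Suc m)) - y (u i m)"])
    show "indep_vars (\<lambda>_. \<Pi>\<^sub>M t\<in>{0..}. borel) (\<lambda>k \<omega>. \<lambda>t\<in>{0..}. W i k t \<omega>) {..<P i}"
      using driver i by (auto simp: tree_driver_def standard_vector_BM_def)
  next
    fix k assume k: "k \<in> {..<P i}"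
    have "u i m < u i (Suc m)" for m
      using stage_time_less[OF i] n by (simp add: u_def divide_strict_right_mono)
    moreover have "u i 0 = 0" by (simp add: u_def)
    ultimately have "0 \<le> u i 0 \<and> (\<forall>m<n. u i m < u i (Suc m))" by simp
    moreover have "standard_BM M (W i k)" using W_BM[OF i, of k] k by simp
    ultimately show "indep_vars (\<lambda>_. borel) (\<lambda>m \<omega>. W i k (u i (Suc m)) \<omega> - W i k (u i m) \<omega>) {..<n}"
      unfolding standard_BM_def by blast
  next
    fix k m assume "k \<in> {..<P i}" "m \<in> {..<n}"
    show "(\<lambda>y. y (u i (Suc m)) - y (u i m)) \<in> (\<Pi>\<^sub>M t\<in>{0..}. borel) \<rightarrow>\<^sub>M (borel :: real measure)"
      using u0[OF i] by (intro borel_measurable_diff measurable_component_singleton) auto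
  qed (use u0[OF i] in auto)
  have "indep_vars (\<lambda>_. borel) (\<lambda>(i, x). X i x) (SIGMA i:{..\<eta>}. SIGMA k:{..<P i}. {..<n})"
  proof (rule indep_vars_nested[where Y = "\<lambda>i \<omega>. \<lambda>kt\<in>{..<P i} \<times> {0..}. W i (fst kt) (snd kt) \<omega>"
        and N = "\<lambda>i. \<Pi>\<^sub>M kt\<in>{..<P i} \<times> {0..}. borel"
        and f = "\<lambda>i x y. y (fst x, u i (Suc (snd x))) - y (fst x, u i (snd x))"])
    show "indep_vars (\<lambda>i. \<Pi>\<^sub>M kt\<in>{..<P i} \<times> {0..}. borel)
        (\<lambda>i \<omega>. \<lambda>kt\<in>{..<P i} \<times> {0..}. W i (fst kt) (snd kt) \<omega>) {..\<eta>}"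
      using driver by (simp add: tree_driver_def)
  next
    fix i x assume "i \<in> {..\<eta>}" "x \<in> (SIGMA k:{..<P i}. {..<n})"
    then show "(\<lambda>y. y (fst x, u i (Suc (snd x))) - y (fst x, u i (snd x)))
        \<in> (\<Pi>\<^sub>M kt\<in>{..<P i} \<times> {0..}. borel) \<rightarrow>\<^sub>M (borel :: real measure)"
      using u0 by (intro borel_measurable_diff measurable_component_singleton) auto
  qed (use stage u0 in \<open>auto simp: X_def\<close>)
  then have "indep_vars (\<lambda>_. borel) (\<lambda>lk. (\<lambda>(i, x). X i x) ((\<lambda>(l, k). (l div n, k, l mod n)) lk))
      (SIGMA l:{..<Suc \<eta> * n}. {..<P (l div n)})"
  proof (rule indep_vars_reindex)
    show "inj_on (\<lambda>(l, k). (l div n, k, l mod n)) (SIGMA l:{..<Suc \<eta> * n}. {..<P (l div n)})"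
      by (intro inj_onI) (auto, metis div_mult_mod_eq)
    show "(\<lambda>(l, k). (l div n, k, l mod n)) ` (SIGMA l:{..<Suc \<eta> * n}. {..<P (l div n)})
      \<subseteq> (SIGMA i:{..\<eta>}. SIGMA k:{..<P i}. {..<n})"
      using n stage_le by (auto simp del: mult_Suc)
  qed
  moreover have "(\<lambda>lk. (\<lambda>(i, x). X i x) ((\<lambda>(l, k). (l div n, k, l mod n)) lk)) = (\<lambda>(l, k). coord_step n l k)"
  proof -
    have "grid n l - stage_time (l div n) = u (l div n) (l mod n)" for l
      by (simp add: grid_def u_def)
    moreover have "grid n (Suc l) - stage_time (l div n) = u (l div n) (Suc (l mod n))" for l
      by (simp only: grid_Suc[OF n] u_def add_diff_cancel_left')
    ultimately show ?thesis by (simp only: fun_eq_iff X_def coord_step_def split_beta prod.case fst_conv snd_conv) simp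
  qed
  ultimately show ?thesis by simp
qed

text \<open>
  All walks that occur are driven by one fixed linear combination of the coordinates in each stage: the coefficients
  \<open>a\<close> depend on the stage and the coordinate only. The energy of \<open>a\<close> below is the rate at
  which the variance of the combination grows.
\<close>

definition comb_step :: "nat \<Rightarrow> (nat \<Rightarrow> nat \<Rightarrow> real) \<Rightarrow> nat \<Rightarrow> 'a \<Rightarrow> real" where
  "comb_step n a l \<omega> = (\<Sum>k<P (l div n). a (l div n) k * coord_step n l k \<omega>)"

lemma comb_step_indep:
  assumes "0 < n" "b \<le> Suc \<eta> * n"
  shows "indep_vars (\<lambda>_. borel) (comb_step n a) {m..<b}"
proof -
  have "indep_vars (\<lambda>_. borel) (comb_step n a) {..<Suc \<eta> * n}"
    unfolding comb_step_def[abs_def] by (intro indep_vars_group_sums coord_step_indep assms(1)) auto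
  then show ?thesis by (rule indep_vars_subset) (use assms(2) in auto)
qed

definition energy :: "(nat \<Rightarrow> nat \<Rightarrow> real) \<Rightarrow> nat \<Rightarrow> real" where
  "energy a i = (\<Sum>k<P i. (a i k)\<^sup>2)"

lemma comb_step_normal:
  assumes "0 < n" "b \<le> Suc \<eta> * n"
  shows "centred_normal (\<lambda>\<omega>. \<Sum>l\<in>{m..<b}. comb_step n a l \<omega>) (\<Sum>l\<in>{m..<b}. energy a (l div n) * grid_step n l)"
proof -
  let ?I = "SIGMA l:{m..<b}. {..<P (l div n)}"
  have "centred_normal (\<lambda>\<omega>. \<Sum>x\<in>?I. (case x of (l, k) \<Rightarrow> a (l div n) k) * (case x of (l, k) \<Rightarrow> coord_step n l k) \<omega>)
     (\<Sum>x\<in>?I. (case x of (l, k) \<Rightarrow> a (l div n) k)\<^sup>2 * (case x of (l, k) \<Rightarrow> grid_step n l))"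
  proof (rule centred_normal_sum)
    show "indep_vars (\<lambda>_. borel) (\<lambda>(l, k). coord_step n l k) ?I"
      using assms by (intro indep_vars_subset[OF coord_step_indep[OF assms(1)]]) auto
  qed (use assms in \<open>auto intro!: coord_step_normal\<close>)
  moreover have e: "(\<Sum>x\<in>?I. g (fst x) (snd x)) = (\<Sum>l\<in>{m..<b}. \<Sum>k<P (l div n). g l k)" for g :: "nat \<Rightarrow> nat \<Rightarrow> real"
    by (subst sum.Sigma) (auto simp: split_beta)
  ultimately show ?thesis
    using e[of "\<lambda>l k. a (l div n) k * coord_step n l k \<omega>" for \<omega>] e[of "\<lambda>l k. (a (l div n) k)\<^sup>2 * grid_step n l"]
    by (simp only: case_prod_unfold comb_step_def energy_def sum_distrib_right)
qed

end

section \<open>Differences of branches and their passage probabilities\<close>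

lemma sum_of_bool_mult:
  fixes K :: nat
  assumes "a < K"
  shows "(\<Sum>k<K. of_bool (k = a) * of_bool (k = b)) = (of_bool (a = b) :: real)"
proof -
  have "(\<Sum>k<K. of_bool (k = a) * of_bool (k = b)) = (\<Sum>k<K. if k = a then of_bool (a = b) else (0 :: real))"
    by (intro sum.cong) auto
  then show ?thesis using assms by simp
qed

text \<open>
  Each unordered pair is counted twice in the correction, which does no harm for bounds up to a constant.
\<close>

lemma (in prob_space) bonferroni_lower:
  assumes "finite S" "\<And>p. p \<in> S \<Longrightarrow> A p \<in> events"
  shows "(\<Sum>p\<in>S. prob (A p)) \<le> prob (\<Union>p\<in>S. A p) + (\<Sum>p\<in>S. \<Sum>q\<in>S - {p}. prob (A p \<inter> A q))"
  using assms
proof (induction S rule: finite_induct)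
  case (insert x S)
  let ?U = "\<Union>p\<in>S. A p"
  have U: "?U \<in> events" using insert by (intro sets.finite_UN) auto
  have "prob (A x) + prob ?U = prob (A x \<union> ?U) + prob (A x \<inter> ?U)"
    using insert U finite_measure_Union'[of "A x" ?U] finite_measure_Union'[of "?U" "A x"]
      finite_measure_Diff'[of ?U "A x"] by (simp add: Un_commute Int_commute)
  moreover have "prob (A x \<inter> ?U) \<le> (\<Sum>q\<in>S. prob (A x \<inter> A q))"
  proof -
    have comb_step_eq: "A x \<inter> ?U = (\<Union>q\<in>S. A x \<inter> A q)" by auto
    show ?thesis unfolding comb_step_eq using insert by (intro finite_measure_subadditive_finite) auto
  qed
  moreover have "(\<Sum>p\<in>S. \<Sum>q\<in>S - {p}. prob (A p \<inter> A q)) \<le> (\<Sum>p\<in>S. \<Sum>q\<in>insert x S - {p}. prob (A p \<inter> A q))"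
    using insert by (intro sum_mono sum_mono2) auto
  moreover have "insert x S - {x} = S" using insert by auto
  ultimately show ?case using insert by simp
qed simp

context decision_tree
begin

definition pair_coeff :: "nat \<times> nat \<Rightarrow> nat \<Rightarrow> nat \<Rightarrow> real" where
  "pair_coeff p i k = of_bool (k = fst p mod P i) - of_bool (k = snd p mod P i)"

definition pair_walk :: "nat \<Rightarrow> nat \<times> nat \<Rightarrow> nat \<Rightarrow> 'a \<Rightarrow> real" where
  "pair_walk n p l \<omega> = (\<Sum>l'\<in>{0..<l}. comb_step n (pair_coeff p) l' \<omega>)"

text \<open>
  By the divisibility of the moduli, two branches that sit at different coordinates after the first branching
  point do so in all later stages, and otherwise they coincide at least up to the second one.
\<close>

definition separated :: "nat \<times> nat \<Rightarrow> bool" where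
  "separated p \<longleftrightarrow> fst p mod P 1 \<noteq> snd p mod P 1"

lemma separated_mod: "separated p \<Longrightarrow> 1 \<le> i \<Longrightarrow> fst p mod P i \<noteq> snd p mod P i"
  using P_dvd[of 1 i] unfolding separated_def by (metis mod_mod_cancel)

lemma not_separated_mod: "\<not> separated p \<Longrightarrow> i \<le> 1 \<Longrightarrow> fst p mod P i = snd p mod P i"
  by (cases i) (auto simp: separated_def P_0)

lemma comb_step_pair_coeff:
  assumes "0 < n" "l < Suc \<eta> * n"
  shows "comb_step n (pair_coeff p) l \<omega> = coord_step n l (fst p mod P (l div n)) \<omega> - coord_step n l (snd p mod P (l div n)) \<omega>"
proof -
  have "(\<Sum>k<P (l div n). of_bool (k = x mod P (l div n)) * coord_step n l k \<omega>) = coord_step n l (x mod P (l div n)) \<omega>" for x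
  proof -
    have "x mod P (l div n) < P (l div n)" using P_pos stage_le[OF assms] by simp
    moreover have "(\<Sum>k<P (l div n). of_bool (k = x mod P (l div n)) * coord_step n l k \<omega>)
      = (\<Sum>k<P (l div n). if k = x mod P (l div n) then coord_step n l (x mod P (l div n)) \<omega> else 0)"
      by (intro sum.cong) auto
    ultimately show ?thesis by simp
  qed
  then show ?thesis by (simp add: comb_step_def pair_coeff_def left_diff_distrib sum_subtractf)
qed

lemma pair_walk_eq_tree_diff:
  assumes "0 < n" "\<omega> \<in> space M" "l \<le> Suc \<eta> * n"
  shows "pair_walk n p l \<omega> = tree_branch \<eta> N \<tau> W (fst p) (grid n l) \<omega> - tree_branch \<eta> N \<tau> W (snd p) (grid n l) \<omega>"
proof -
  have "pair_walk n p l \<omega> = (\<Sum>l'<l. coord_step n l' (fst p mod P (l' div n)) \<omega> - coord_step n l' (snd p mod P (l' div n)) \<omega>)"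
    unfolding pair_walk_def using assms by (intro sum.cong comb_step_pair_coeff) auto
  then show ?thesis using assms by (simp add: tree_branch_grid sum_subtractf del: mult_Suc)
qed

lemma energy_pair_coeff:
  assumes "i \<le> \<eta>"
  shows "energy (pair_coeff p) i = (if fst p mod P i = snd p mod P i then 0 else 2)"
proof -
  let ?a = "fst p mod P i" and ?b = "snd p mod P i"
  let ?e = "\<lambda>x k. of_bool (k = x) :: real"
  have lt: "?a < P i" "?b < P i" using P_pos[OF assms] by auto
  have "energy (pair_coeff p) i = (\<Sum>k<P i. ?e ?a k * ?e ?a k + ?e ?b k * ?e ?b k - 2 * (?e ?a k * ?e ?b k))"
    unfolding energy_def pair_coeff_def by (intro sum.cong) (auto simp: power2_eq_square algebra_simps)
  also have "\<dots> = 1 + 1 - 2 * of_bool (?a = ?b)"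
    by (simp only: sum.distrib sum_subtractf sum_distrib_left[symmetric] sum_of_bool_mult[OF lt(1)] sum_of_bool_mult[OF lt(2)]) simp
  finally show ?thesis by simp
qed

lemma energy_pair_coeff_le: "i \<le> \<eta> \<Longrightarrow> energy (pair_coeff p) i \<le> 2"
  by (simp add: energy_pair_coeff)

lemma energy_add_le:
  assumes "i \<le> \<eta>"
  shows "energy (\<lambda>i k. pair_coeff p i k + pair_coeff q i k) i \<le> 8"
proof -
  have "energy (\<lambda>i k. pair_coeff p i k + pair_coeff q i k) i
    \<le> (\<Sum>k<P i. 2 * (pair_coeff p i k)\<^sup>2 + 2 * (pair_coeff q i k)\<^sup>2)"
    unfolding energy_def
  proof (intro sum_mono)
    fix k
    have "0 \<le> (pair_coeff p i k - pair_coeff q i k)\<^sup>2" by simp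
    then show "(pair_coeff p i k + pair_coeff q i k)\<^sup>2 \<le> 2 * (pair_coeff p i k)\<^sup>2 + 2 * (pair_coeff q i k)\<^sup>2"
      by (simp add: power2_eq_square algebra_simps)
  qed
  also have "\<dots> = 2 * energy (pair_coeff p) i + 2 * energy (pair_coeff q) i"
    by (simp add: energy_def sum.distrib sum_distrib_left)
  also have "\<dots> \<le> 8" using energy_pair_coeff_le[OF assms] by (simp add: add_mono[of _ 4 _ 4, simplified])
  finally show ?thesis .
qed

text \<open>
  In the last stage distinct branches have distinct coordinates. Expanding the square, the mixed terms of
  the two differences contribute at most 2, because the two pairs can agree in their first or in their second
  entry but not in both. Equality of the pairs would give 8.
\<close>

lemma energy_add_last_le:
  assumes p: "p \<in> {0..<P \<eta>} \<times> {0..<P \<eta>}" and q: "q \<in> {0..<P \<eta>} \<times> {0..<P \<eta>}"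
    and ne: "fst p \<noteq> snd p" "fst q \<noteq> snd q" "p \<noteq> q"
  shows "energy (\<lambda>i k. pair_coeff p i k + pair_coeff q i k) \<eta> \<le> 6"
proof -
  obtain a b a' b' where ab: "p = (a, b)" "q = (a', b')" by (cases p, cases q)
  have lt: "a < P \<eta>" "b < P \<eta>" "a' < P \<eta>" "b' < P \<eta>" using p q ab by auto
  let ?e = "\<lambda>x k. of_bool (k = x) :: real"
  have "energy (\<lambda>i k. pair_coeff p i k + pair_coeff q i k) \<eta> =
     (\<Sum>k<P \<eta>. (?e a k - ?e b k + (?e a' k - ?e b' k))\<^sup>2)"
    using lt by (simp add: energy_def pair_coeff_def ab)
  also have "\<dots> = (\<Sum>k<P \<eta>. ?e a k * ?e a k + ?e b k * ?e b k + ?e a' k * ?e a' k + ?e b' k * ?e b' k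
      - 2 * (?e a k * ?e b k) + 2 * (?e a k * ?e a' k) - 2 * (?e a k * ?e b' k)
      - 2 * (?e b k * ?e a' k) + 2 * (?e b k * ?e b' k) - 2 * (?e a' k * ?e b' k))"
    by (intro sum.cong refl) (simp add: power2_eq_square algebra_simps del: mult_cancel_left1 of_bool_eq_iff)
  also have "\<dots> = 1 + 1 + 1 + 1 - 2 * of_bool (a = b) + 2 * of_bool (a = a') - 2 * of_bool (a = b')
      - 2 * of_bool (b = a') + 2 * of_bool (b = b') - 2 * of_bool (a' = b')"
    by (simp only: sum.distrib sum_subtractf sum_distrib_left[symmetric] lt[THEN sum_of_bool_mult]) simp
  also have "\<dots> \<le> 6" using ne ab by auto
  finally show ?thesis .
qed

lemma sum_energy_le:
  assumes n: "0 < n" and ab: "a \<le> b" "b \<le> Suc \<eta> * n"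
    and e: "\<And>l. a \<le> l \<Longrightarrow> l < b \<Longrightarrow> energy x (l div n) \<le> e"
  shows "(\<Sum>l\<in>{a..<b}. energy x (l div n) * grid_step n l) \<le> e * (grid n b - grid n a)"
proof -
  have "(\<Sum>l\<in>{a..<b}. energy x (l div n) * grid_step n l) \<le> (\<Sum>l\<in>{a..<b}. e * grid_step n l)"
    using ab grid_step_pos[OF n] e by (intro sum_mono mult_right_mono) (auto intro!: less_imp_le)
  then show ?thesis using sum_grid_step[OF n ab(1)] by (simp add: sum_distrib_left[symmetric])
qed

lemma div_stage: "0 < n \<Longrightarrow> l < b \<Longrightarrow> b \<le> Suc \<eta> * n \<Longrightarrow> l div n \<le> \<eta>"
  by (rule stage_le) auto

definition pair_variance :: "nat \<Rightarrow> nat \<times> nat \<Rightarrow> nat \<Rightarrow> nat \<Rightarrow> real" where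
  "pair_variance n p a b = (\<Sum>l\<in>{a..<b}. energy (pair_coeff p) (l div n) * grid_step n l)"

lemma pair_variance_split:
  "a \<le> c \<Longrightarrow> c \<le> b \<Longrightarrow> pair_variance n p a b = pair_variance n p a c + pair_variance n p c b"
  unfolding pair_variance_def by (rule sum.atLeastLessThan_concat[symmetric])

lemma pair_variance_le:
  "0 < n \<Longrightarrow> a \<le> b \<Longrightarrow> b \<le> Suc \<eta> * n \<Longrightarrow> pair_variance n p a b \<le> 2 * (grid n b - grid n a)"
  unfolding pair_variance_def by (intro sum_energy_le energy_pair_coeff_le) (auto intro: div_stage)

lemma pair_variance_separated:
  assumes n: "0 < n" and b: "n \<le> b" "b \<le> Suc \<eta> * n" and p: "separated p"
  shows "pair_variance n p 0 b = 2 * (grid n b - \<tau> 1)"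
proof -
  have "pair_variance n p 0 n = 0"
    unfolding pair_variance_def by (intro sum.neutral) (auto simp: energy_pair_coeff P_0)
  moreover have "pair_variance n p n b = (\<Sum>l\<in>{n..<b}. 2 * grid_step n l)"
    unfolding pair_variance_def
  proof (intro sum.cong refl)
    fix l assume l: "l \<in> {n..<b}"
    then have "1 \<le> l div n" using n div_greater_zero_iff[of l n] by auto
    moreover have "l div n \<le> \<eta>" using l b n by (intro div_stage[of n l b]) auto
    ultimately show "energy (pair_coeff p) (l div n) * grid_step n l = 2 * grid_step n l"
      using separated_mod[OF p] by (simp add: energy_pair_coeff)
  qed
  moreover have "grid n n = \<tau> 1" using grid_multiple[OF n, of 1] by (simp add: stage_time_simps)
  ultimately show ?thesis
    using pair_variance_split[of 0 n b n p] b sum_grid_step[OF n b(1)] by (simp add: sum_distrib_left[symmetric])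
qed

lemma pair_variance_not_separated:
  assumes n: "0 < n" and p: "\<not> separated p"
  shows "pair_variance n p 0 (Suc \<eta> * n) \<le> 2 * (T - stage_time 2)"
proof -
  have "2 * n \<le> Suc \<eta> * n" using \<eta> by (intro mult_right_mono) auto
  have "pair_variance n p 0 (2 * n) = 0"
    unfolding pair_variance_def
  proof (intro sum.neutral ballI)
    fix l assume l: "l \<in> {0..<2 * n}"
    then have "l div n < 2" by (intro less_mult_imp_div_less) auto
    then have "l div n \<le> 1" by simp
    then show "energy (pair_coeff p) (l div n) * grid_step n l = 0"
      using not_separated_mod[OF p] \<eta> by (simp add: energy_pair_coeff)
  qed
  then show ?thesis
    using pair_variance_split[of 0 "2 * n" "Suc \<eta> * n" n p] \<open>2 * n \<le> Suc \<eta> * n\<close>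
      pair_variance_le[OF n \<open>2 * n \<le> Suc \<eta> * n\<close> order_refl, of p] grid_multiple[OF n, of "Suc \<eta>"] grid_multiple[OF n, of 2]
    by (simp add: stage_time_simps del: mult_Suc)
qed

lemma pair_walk_normal:
  assumes "0 < n" "b \<le> Suc \<eta> * n"
  shows "centred_normal (\<lambda>\<omega>. \<Sum>l\<in>{a..<b}. comb_step n (pair_coeff p) l \<omega>) (pair_variance n p a b)"
  unfolding pair_variance_def by (rule comb_step_normal[OF assms])

text \<open>
  The walk is restarted from 0 at \<open>a\<close>, so that the same event describes both passages from the
  beginning and rises during a final stretch of time.
\<close>

definition passage :: "nat \<Rightarrow> nat \<times> nat \<Rightarrow> nat \<Rightarrow> nat \<Rightarrow> real \<Rightarrow> 'a set" where
  "passage n p a b u = {\<omega>\<in>space M. \<exists>l\<in>{a..b}. (\<Sum>l'\<in>{a..<l}. comb_step n (pair_coeff p) l' \<omega>) > u}"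

lemma pair_walk_measurable:
  "0 < n \<Longrightarrow> b \<le> Suc \<eta> * n \<Longrightarrow> random_variable borel (\<lambda>\<omega>. \<Sum>l\<in>{a..<b}. comb_step n (pair_coeff p) l \<omega>)"
  by (rule centred_normal_measurable[OF pair_walk_normal])

lemma passage_event: "0 < n \<Longrightarrow> b \<le> Suc \<eta> * n \<Longrightarrow> passage n p a b u \<in> events"
  unfolding passage_def
  by (intro sets.sets_Collect_finite_Ex borel_measurable_less pair_walk_measurable) auto

lemma passage_levy:
  assumes "0 < n" "a \<le> b" "b \<le> Suc \<eta> * n"
  shows "prob (passage n p a b u) \<le> 2 * prob {\<omega>\<in>space M. (\<Sum>l\<in>{a..<b}. comb_step n (pair_coeff p) l \<omega>) > u}"
  unfolding passage_def using assms
  by (intro levy_maximal_inequality[where v = "\<lambda>k. pair_variance n p k b"] comb_step_indep pair_walk_normal) auto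

lemma passage_exp_bound:
  assumes "0 < n" "a \<le> b" "b \<le> Suc \<eta> * n" "pair_variance n p a b \<le> v" "0 < v" "0 \<le> u"
  shows "prob (passage n p a b u) \<le> 2 * exp (- (u\<^sup>2 / (2 * v)))"
  using passage_levy[OF assms(1-3), of p u] centred_normal_tail_exp[OF pair_walk_normal[OF assms(1,3)] assms(4-6)]
  by (meson dual_order.trans mult_left_mono zero_le_numeral)

text \<open>
  Each of the steps has variance at most \<open>2 * T / n\<close>, so the chance of a step beyond \<open>\<epsilon>\<close> decays
  exponentially in \<open>n\<close> and outweighs the number of steps.
\<close>

lemma passage_lower_bound:
  assumes n: "0 < n" and "0 \<le> u" "0 < \<epsilon>"
  defines "L \<equiv> Suc \<eta> * n"
  shows "2 * prob {\<omega>\<in>space M. pair_walk n p L \<omega> > u + 2 * \<epsilon>} \<le>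
    prob (passage n p 0 L u) + real L * exp (- (\<epsilon>\<^sup>2 / (4 * T)) * real n)"
proof -
  have T: "0 < T" using stage_time_less[of \<eta>] stage_time_nonneg[of \<eta>] by (simp add: stage_time_simps)
  have step: "prob {\<omega>\<in>space M. comb_step n (pair_coeff p) l \<omega> > \<epsilon>} \<le> exp (- (\<epsilon>\<^sup>2 / (4 * T)) * real n)" if l: "l < L" for l
  proof -
    have "pair_variance n p l (Suc l) \<le> 2 * (T / real n)"
      using pair_variance_le[of n l "Suc l" p] grid_Suc_diff[OF n, of l] grid_step_le[OF n, of l] l n unfolding L_def
      by simp
    then have "prob {\<omega>\<in>space M. (\<Sum>l'\<in>{l..<Suc l}. comb_step n (pair_coeff p) l' \<omega>) > \<epsilon>} \<le> exp (- (\<epsilon>\<^sup>2 / (2 * (2 * (T / real n)))))"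
      using l n T assms unfolding L_def
      by (intro centred_normal_tail_exp[OF pair_walk_normal]) auto
    then show ?thesis by (simp add: mult.commute)
  qed
  have "2 * prob {\<omega>\<in>space M. (\<Sum>l\<in>{0..<L}. comb_step n (pair_coeff p) l \<omega>) > u + 2 * \<epsilon>} \<le>
    prob (passage n p 0 L u) + (\<Sum>l\<in>{0..<L}. prob {\<omega>\<in>space M. comb_step n (pair_coeff p) l \<omega> > \<epsilon>})"
    unfolding passage_def L_def using assms
    by (intro reflection_lower_bound[where v = "\<lambda>k. pair_variance n p k (Suc \<eta> * n)"] comb_step_indep pair_walk_normal) auto
  also have "(\<Sum>l\<in>{0..<L}. prob {\<omega>\<in>space M. comb_step n (pair_coeff p) l \<omega> > \<epsilon>}) \<le> (\<Sum>l\<in>{0..<L}. exp (- (\<epsilon>\<^sup>2 / (4 * T)) * real n))"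
    using step by (intro sum_mono) auto
  finally show ?thesis by (simp add: pair_walk_def)
qed

text \<open>
  If neither walk passes \<open>u\<close> by time \<open>b\<close> and neither rises by more than \<open>\<theta> * u\<close> after \<open>b\<close>, both must be
  above \<open>(1 - \<theta>) * u\<close> at \<open>b\<close> already.
\<close>

lemma joint_passage_subset:
  assumes b: "b \<le> L"
  shows "passage n p 0 L u \<inter> passage n q 0 L u \<subseteq>
    passage n p 0 b u \<union> passage n q 0 b u \<union> passage n p b L (\<theta> * u) \<union> passage n q b L (\<theta> * u)
    \<union> {\<omega>\<in>space M. pair_walk n p b \<omega> + pair_walk n q b \<omega> > 2 * (1 - \<theta>) * u}"
proof -
  have late: "pair_walk n r b \<omega> > (1 - \<theta>) * u"
    if r: "\<omega> \<in> passage n r 0 L u" "\<omega> \<notin> passage n r 0 b u" "\<omega> \<notin> passage n r b L (\<theta> * u)" for r \<omega>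
  proof -
    obtain l where l: "l \<le> L" "pair_walk n r l \<omega> > u" and \<omega>: "\<omega> \<in> space M"
      using r(1) by (auto simp: passage_def pair_walk_def)
    have "b \<le> l"
    proof (rule ccontr)
      assume "\<not> b \<le> l"
      then have "\<omega> \<in> passage n r 0 b u" using l \<omega> by (auto simp: passage_def pair_walk_def intro!: bexI[of _ l])
      then show False using r by simp
    qed
    then have "pair_walk n r l \<omega> = pair_walk n r b \<omega> + (\<Sum>l'\<in>{b..<l}. comb_step n (pair_coeff r) l' \<omega>)"
      unfolding pair_walk_def by (subst sum.atLeastLessThan_concat) auto
    moreover have "(\<Sum>l'\<in>{b..<l}. comb_step n (pair_coeff r) l' \<omega>) \<le> \<theta> * u"
      using r(3) \<omega> l \<open>b \<le> l\<close> by (force simp: passage_def)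
    ultimately show ?thesis using l by (simp add: algebra_simps)
  qed
  show ?thesis
  proof
    fix \<omega> assume \<omega>: "\<omega> \<in> passage n p 0 L u \<inter> passage n q 0 L u"
    show "\<omega> \<in> passage n p 0 b u \<union> passage n q 0 b u \<union> passage n p b L (\<theta> * u) \<union> passage n q b L (\<theta> * u)
      \<union> {\<omega>\<in>space M. pair_walk n p b \<omega> + pair_walk n q b \<omega> > 2 * (1 - \<theta>) * u}"
    proof (rule ccontr)
      assume n: "\<not> ?thesis"
      have "pair_walk n p b \<omega> > (1 - \<theta>) * u" "pair_walk n q b \<omega> > (1 - \<theta>) * u"
        using late[of \<omega> p] late[of \<omega> q] \<omega> n by auto
      then have "pair_walk n p b \<omega> + pair_walk n q b \<omega> > 2 * (1 - \<theta>) * u" by (simp add: algebra_simps)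
      moreover have "\<omega> \<in> space M" using \<omega> by (auto simp: passage_def)
      ultimately show False using n by auto
    qed
  qed
qed

text \<open>
  The sum of the two walks does not move in stage 0, has variance rate at most 8 between \<open>\<tau> 1\<close>
  and \<open>\<tau> \<eta>\<close>, and at most 6 from \<open>\<tau> \<eta>\<close> on.
\<close>

lemma joint_walk_exp_bound:
  assumes n: "0 < n" and b: "\<eta> * n \<le> b" "b \<le> Suc \<eta> * n"
    and p: "p \<in> {0..<P \<eta>} \<times> {0..<P \<eta>}" "separated p" and q: "q \<in> {0..<P \<eta>} \<times> {0..<P \<eta>}" "separated q"
    and pq: "p \<noteq> q" and x: "0 \<le> x"
  shows "prob {\<omega>\<in>space M. pair_walk n p b \<omega> + pair_walk n q b \<omega> > x}
    \<le> exp (- (x\<^sup>2 / (2 * (8 * (T - \<tau> 1) - 2 * (T - \<tau> \<eta>)))))"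
proof -
  let ?a = "\<lambda>i k. pair_coeff p i k + pair_coeff q i k"
  let ?e = "\<lambda>l. energy ?a (l div n) * grid_step n l"
  have nb: "n \<le> \<eta> * n" using \<eta> by simp
  have "(\<Sum>l\<in>{0..<b}. ?e l) = (\<Sum>l\<in>{0..<n}. ?e l) + (\<Sum>l\<in>{n..<\<eta>*n}. ?e l) + (\<Sum>l\<in>{\<eta>*n..<b}. ?e l)"
    by (simp only: sum.atLeastLessThan_concat[OF le0 nb] sum.atLeastLessThan_concat[OF le0 b(1)])
  also have "(\<Sum>l\<in>{0..<n}. ?e l) = 0"
    by (intro sum.neutral) (auto simp: energy_def pair_coeff_def P_0)
  also have "(\<Sum>l\<in>{n..<\<eta>*n}. ?e l) \<le> 8 * (grid n (\<eta>*n) - grid n n)"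
    using n nb b by (intro sum_energy_le energy_add_le) (auto intro: div_stage[of n _ b])
  also have "(\<Sum>l\<in>{\<eta>*n..<b}. ?e l) \<le> 6 * (grid n b - grid n (\<eta>*n))"
  proof (rule sum_energy_le[OF n b])
    fix l assume l: "\<eta> * n \<le> l" "l < b"
    have "\<eta> \<le> l div n" using l(1) n by (simp add: less_eq_div_iff_mult_less_eq)
    moreover have "l div n \<le> \<eta>" using l b n by (intro div_stage[of n l b]) auto
    ultimately have "l div n = \<eta>" by simp
    moreover have "fst p \<noteq> snd p" "fst q \<noteq> snd q" using p q by (auto simp: separated_def)
    ultimately show "energy ?a (l div n) \<le> 6" using energy_add_last_le[OF p(1) q(1)] pq by simp
  qed
  also have "grid n b \<le> T"
    using grid_mono[OF b(2) n order_refl] grid_multiple[OF n, of "Suc \<eta>"] by (simp add: stage_time_simps)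
  finally have var: "(\<Sum>l\<in>{0..<b}. ?e l) \<le> 8 * (T - \<tau> 1) - 2 * (T - \<tau> \<eta>)"
    using grid_multiple[OF n, of 1] grid_multiple[OF n, of \<eta>] by (simp add: stage_time_simps)
  have "\<tau> 1 \<le> \<tau> \<eta>" using stage_time_mono[of 1 \<eta>] \<eta> by (simp add: stage_time_simps)
  have "pair_walk n p b \<omega> + pair_walk n q b \<omega> = (\<Sum>l\<in>{0..<b}. comb_step n ?a l \<omega>)" for \<omega>
    by (simp add: pair_walk_def comb_step_def sum.distrib[symmetric] distrib_right)
  moreover have "prob {\<omega>\<in>space M. (\<Sum>l\<in>{0..<b}. comb_step n ?a l \<omega>) > x} \<le> exp (- (x\<^sup>2 / (2 * (8 * (T - \<tau> 1) - 2 * (T - \<tau> \<eta>)))))"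
    using \<tau>_last \<open>\<tau> 1 \<le> \<tau> \<eta>\<close> by (intro centred_normal_tail_exp[OF comb_step_normal[OF n b(2)] var] x) auto
  ultimately show ?thesis by simp
qed

end

section \<open>From grid times to continuous time\<close>

context decision_tree
begin

abbreviation "\<Gamma>_pairs \<equiv> {0..<P \<eta>} \<times> {0..<P \<eta>}"

abbreviation "spread_event \<equiv> tree_spread_event M T \<eta> N \<tau> W"

abbreviation "grid_event n u \<equiv> (\<Union>p\<in>\<Gamma>_pairs. passage n p 0 (Suc \<eta> * n) u)"

lemma in_passage_iff:
  assumes "0 < n"
  shows "\<omega> \<in> passage n p 0 (Suc \<eta> * n) u \<longleftrightarrow> \<omega> \<in> space M \<and> (\<exists>l\<le>Suc \<eta> * n.
    tree_branch \<eta> N \<tau> W (fst p) (grid n l) \<omega> - tree_branch \<eta> N \<tau> W (snd p) (grid n l) \<omega> > u)"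
proof (cases "\<omega> \<in> space M")
  case True
  have "\<omega> \<in> passage n p 0 (Suc \<eta> * n) u \<longleftrightarrow> (\<exists>l\<le>Suc \<eta> * n. pair_walk n p l \<omega> > u)"
    using True by (simp add: passage_def pair_walk_def Bex_def del: mult_Suc)
  then show ?thesis
    using True by (simp add: pair_walk_eq_tree_diff[OF assms True] cong: conj_cong del: mult_Suc)
qed (simp add: passage_def)

lemma grid_event_subset:
  assumes n: "0 < n"
  shows "grid_event n u \<subseteq> spread_event u"
proof
  fix \<omega> assume "\<omega> \<in> grid_event n u"
  then obtain p l where p: "p \<in> \<Gamma>_pairs" and l: "l \<le> Suc \<eta> * n" and \<omega>: "\<omega> \<in> space M"
    "tree_branch \<eta> N \<tau> W (fst p) (grid n l) \<omega> - tree_branch \<eta> N \<tau> W (snd p) (grid n l) \<omega> > u"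
    by (auto simp: in_passage_iff[OF n] simp del: mult_Suc)
  have "grid n 0 \<le> grid n l" "grid n l \<le> grid n (Suc \<eta> * n)"
    using grid_mono[OF _ n] l by auto
  then have "grid n l \<in> {0..T}"
    using grid_multiple[OF n, of 0] grid_multiple[OF n, of "Suc \<eta>"] by (simp add: stage_time_simps)
  then show "\<omega> \<in> spread_event u" using p \<omega> unfolding tree_spread_event_def
    by (intro CollectI conjI bexI[of _ "grid n l"] bexI[of _ "fst p"] bexI[of _ "snd p"]) auto
qed

lemma grid_double: "0 < n \<Longrightarrow> grid (2 * n) (2 * l) = grid n l"
proof -
  have "(2 * l) div (2 * n) = l div n" by simp
  moreover have "(2 * l) mod (2 * n) = 2 * (l mod n)" by simp
  ultimately show ?thesis by (simp add: grid_def)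
qed

lemma grid_event_double:
  assumes n: "0 < n"
  shows "grid_event n u \<subseteq> grid_event (2 * n) u"
proof (intro UN_mono order_refl subsetI)
  fix \<omega> p assume "\<omega> \<in> passage n p 0 (Suc \<eta> * n) u"
  then obtain l where l: "l \<le> Suc \<eta> * n" and \<omega>: "\<omega> \<in> space M"
    "tree_branch \<eta> N \<tau> W (fst p) (grid n l) \<omega> - tree_branch \<eta> N \<tau> W (snd p) (grid n l) \<omega> > u"
    by (auto simp: in_passage_iff[OF n] simp del: mult_Suc)
  have "2 * l \<le> Suc \<eta> * (2 * n)" using l by simp
  then show "\<omega> \<in> passage (2 * n) p 0 (Suc \<eta> * (2 * n)) u"
    using \<omega> n grid_double[OF n, of l] in_passage_iff[of "2 * n" \<omega> p u] by (metis nat_0_less_mult_iff zero_less_numeral)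
qed

lemma stage_exists:
  assumes "0 \<le> t" "t \<le> T"
  obtains i where "i \<le> \<eta>" "stage_time i \<le> t" "t \<le> stage_time (Suc i)"
proof -
  define i where "i = (LEAST i. t \<le> stage_time (Suc i))"
  have ex: "t \<le> stage_time (Suc \<eta>)" using assms by (simp add: stage_time_simps)
  have "t \<le> stage_time (Suc i)" unfolding i_def by (rule LeastI[of "\<lambda>i. t \<le> stage_time (Suc i)", OF ex])
  moreover have "i \<le> \<eta>" unfolding i_def by (rule Least_le[of "\<lambda>i. t \<le> stage_time (Suc i)", OF ex])
  moreover have "stage_time i \<le> t"
  proof (cases i)
    case 0 then show ?thesis using assms by (simp add: stage_time_simps)
  next
    case (Suc j)
    then have "\<not> t \<le> stage_time (Suc j)" using not_less_Least[of j "\<lambda>i. t \<le> stage_time (Suc i)"] by (auto simp: i_def[symmetric])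
    then show ?thesis using Suc by simp
  qed
  ultimately show ?thesis using that by blast
qed

lemma tree_segment_continuous:
  assumes i: "i \<le> \<eta>" and k: "k < P i" and \<omega>: "\<omega> \<in> space M"
  shows "continuous_on {stage_time i..} (\<lambda>t. tree_segment N \<tau> W i k t \<omega>)"
proof -
  have "continuous_on {0..} (\<lambda>t. W i k t \<omega>)" using W_BM[OF i k] \<omega> by (auto simp: standard_BM_def)
  then have "continuous_on {stage_time i..} (\<lambda>t. W i k (t - stage_time i) \<omega>)"
    by (rule continuous_on_compose2) (auto intro!: continuous_intros)
  then have c: "continuous_on {stage_time i..} (\<lambda>t. tree_segment N \<tau> W i k (stage_time i) \<omega> + (W i k (t - stage_time i) \<omega> - W i k (stage_time i - stage_time i) \<omega>))"
    by (intro continuous_intros)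
  have eq: "tree_segment N \<tau> W i k t \<omega> =
      tree_segment N \<tau> W i k (stage_time i) \<omega> + (W i k (t - stage_time i) \<omega> - W i k (stage_time i - stage_time i) \<omega>)" for t
    using tree_segment_diff[OF i, of k t \<omega> "stage_time i"] by simp
  show ?thesis by (subst eq) (rule c)
qed

text \<open>
  A difference above \<open>u\<close> at some time \<open>t\<close> stays above \<open>u\<close> near \<open>t\<close> within the closed stage interval that
  contains \<open>t\<close>, and a sufficiently fine grid has a point there.
\<close>

lemma grid_event_exhausts:
  assumes q: "0 < q" and \<omega>: "\<omega> \<in> spread_event u"
  shows "\<exists>r. \<omega> \<in> grid_event (q * 2 ^ r) u"
proof -
  obtain t \<gamma>1 \<gamma>2 where t: "0 \<le> t" "t \<le> T" and \<gamma>: "(\<gamma>1, \<gamma>2) \<in> \<Gamma>_pairs" and sp: "\<omega> \<in> space M"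
    and gt: "tree_branch \<eta> N \<tau> W \<gamma>1 t \<omega> - tree_branch \<eta> N \<tau> W \<gamma>2 t \<omega> > u"
    using \<omega> by (auto simp: tree_spread_event_def)
  obtain i where i: "i \<le> \<eta>" "stage_time i \<le> t" "t \<le> stage_time (Suc i)" using stage_exists[OF t] .
  define f where "f x = tree_segment N \<tau> W i (\<gamma>1 mod P i) x \<omega> - tree_segment N \<tau> W i (\<gamma>2 mod P i) x \<omega>" for x
  have f: "tree_branch \<eta> N \<tau> W \<gamma>1 x \<omega> - tree_branch \<eta> N \<tau> W \<gamma>2 x \<omega> = f x" if "stage_time i \<le> x" "x \<le> stage_time (Suc i)" for x
    using that sp i by (simp add: f_def tree_branch_in_stage)
  have "continuous_on {stage_time i..} f"
    unfolding f_def using i sp P_pos by (intro continuous_intros tree_segment_continuous) auto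
  moreover have "f t - u > 0" using gt f[OF i(2,3)] by simp
  ultimately obtain d where d: "0 < d" "\<And>x. stage_time i \<le> x \<Longrightarrow> \<bar>x - t\<bar> < d \<Longrightarrow> \<bar>f x - f t\<bar> < f t - u"
    using i unfolding continuous_on_iff dist_real_def by (metis atLeast_iff)
  define len where "len = stage_time (Suc i) - stage_time i"
  have len: "0 < len" using stage_time_less[OF i(1)] by (simp add: len_def)
  obtain r where r: "len / d < real r" using reals_Archimedean2 by blast
  define n where "n = q * 2 ^ r"
  have n: "0 < n" using q by (simp add: n_def)
  have "r \<le> n"
  proof -
    have "r \<le> 2 ^ r" using less_exp[of r] by simp
    also have "\<dots> \<le> n" using q by (simp add: n_def)
    finally show ?thesis .
  qed
  then have "len / d < real n" using r by linarith
  then have small: "len / real n < d" using d n by (simp add: field_simps)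
  define m where "m = nat \<lfloor>(t - stage_time i) / len * real n\<rfloor>"
  have frac: "0 \<le> (t - stage_time i) / len" "(t - stage_time i) / len \<le> 1" using i len by (auto simp: len_def)
  have "0 \<le> (t - stage_time i) / len * real n" by (intro mult_nonneg_nonneg frac) simp
  then have "real m = of_int \<lfloor>(t - stage_time i) / len * real n\<rfloor>" unfolding m_def by (intro of_nat_nat) simp
  then have m: "real m \<le> (t - stage_time i) / len * real n" "(t - stage_time i) / len * real n < real m + 1"
    by linarith+
  have "(t - stage_time i) / len * real n \<le> 1 * real n" using frac by (intro mult_right_mono) auto
  then have mn: "m \<le> n" using m by linarith
  define x where "x = stage_time i + len * real m / real n"
  have x_grid: "x = grid n (i * n + m)" using grid_stage[OF n mn] by (simp add: x_def len_def)
  have "len * real m / real n \<le> len" using mn n len by (simp add: divide_le_eq mult_left_mono)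
  then have x: "stage_time i \<le> x" "x \<le> stage_time (Suc i)" using len by (auto simp: x_def len_def)
  have "len * real m \<le> (t - stage_time i) * real n" "(t - stage_time i) * real n < len * real m + len"
    using m len by (auto simp: field_simps)
  then have "len * real m / real n \<le> t - stage_time i" "t - stage_time i < len * real m / real n + len / real n"
    using n by (auto simp: field_simps)
  then have "\<bar>x - t\<bar> < d" using small by (auto simp: x_def)
  then have "f x > u" using d(2)[OF x(1)] by (auto simp: abs_if split: if_splits)
  moreover have "i * n + m \<le> Suc \<eta> * n" using add_mono[OF mult_le_mono1[OF i(1), of n] mn] by simp
  ultimately have "\<omega> \<in> passage n (\<gamma>1, \<gamma>2) 0 (Suc \<eta> * n) u"
    using f[OF x] sp x_grid unfolding in_passage_iff[OF n] by auto
  then show ?thesis unfolding n_def by (intro exI[of _ r] UN_I[OF \<gamma>])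
qed

lemma grid_event_limit:
  assumes q: "0 < q"
  shows "(\<lambda>r. prob (grid_event (q * 2 ^ r) u)) \<longlonglongrightarrow> prob (spread_event u)"
    and "spread_event u \<in> events"
proof -
  have n: "0 < q * 2 ^ r" for r using q by simp
  have ev: "grid_event (q * 2 ^ r) u \<in> events" for r
    by (intro sets.finite_UN passage_event[OF n order_refl]) simp
  have eq: "spread_event u = (\<Union>r. grid_event (q * 2 ^ r) u)"
  proof (intro equalityI subsetI)
    fix \<omega> assume "\<omega> \<in> spread_event u"
    then have "\<exists>r. \<omega> \<in> grid_event (q * 2 ^ r) u" by (rule grid_event_exhausts[OF q])
    then obtain r where r: "\<omega> \<in> grid_event (q * 2 ^ r) u" by (rule exE)
    show "\<omega> \<in> (\<Union>r. grid_event (q * 2 ^ r) u)" by (rule UN_I[OF UNIV_I], rule r)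
  next
    fix \<omega> assume "\<omega> \<in> (\<Union>r. grid_event (q * 2 ^ r) u)"
    then obtain r where "\<omega> \<in> grid_event (q * 2 ^ r) u" by (rule UN_E)
    then show "\<omega> \<in> spread_event u" by (rule subsetD[OF grid_event_subset[OF n]])
  qed
  have inc: "incseq (\<lambda>r. grid_event (q * 2 ^ r) u)"
  proof (rule incseq_SucI)
    fix r
    have "q * 2 ^ Suc r = 2 * (q * 2 ^ r)" by simp
    then show "grid_event (q * 2 ^ r) u \<subseteq> grid_event (q * 2 ^ Suc r) u"
      using grid_event_double[OF n, of r u] by (simp only:)
  qed
  show "spread_event u \<in> events" unfolding eq by (intro sets.countable_UN image_subsetI ev)
  show "(\<lambda>r. prob (grid_event (q * 2 ^ r) u)) \<longlonglongrightarrow> prob (spread_event u)"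
    unfolding eq by (intro finite_Lim_measure_incseq image_subsetI ev inc)
qed

section \<open>Matching bounds for the spread probability\<close>

definition separated_pairs :: "(nat \<times> nat) set" where
  "separated_pairs = {p \<in> \<Gamma>_pairs. separated p}"

definition main_term :: "real \<Rightarrow> real" where
  "main_term u = 2 * sqrt (T - \<tau> 1) / (u * sqrt pi) * exp (- (u\<^sup>2 / (4 * (T - \<tau> 1))))"

lemma \<tau>_bounds: "0 < T - \<tau> 1" "0 < T - \<tau> \<eta>" "T - \<tau> \<eta> \<le> T - \<tau> 1"
  using \<tau>_last stage_time_mono[of 1 \<eta>] \<eta> by (auto simp: stage_time_simps)

text \<open>
  This is Mills' ratio for the variance \<open>2 * (T - \<tau> 1)\<close>; \<open>main_term\<close> is twice its leading term.
\<close>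

lemma separated_tail:
  assumes n: "0 < n" and p: "separated p" and u: "0 < u"
  shows "2 * prob {\<omega>\<in>space M. pair_walk n p (Suc \<eta> * n) \<omega> > u} \<le> main_term u"
    "main_term u / (1 + 2 * (T - \<tau> 1) / u\<^sup>2) \<le> 2 * prob {\<omega>\<in>space M. pair_walk n p (Suc \<eta> * n) \<omega> > u}"
proof -
  have "pair_variance n p 0 (Suc \<eta> * n) = 2 * (T - \<tau> 1)"
    using pair_variance_separated[OF n _ _ p, of "Suc \<eta> * n"] grid_multiple[OF n, of "Suc \<eta>"] by (simp add: stage_time_simps)
  then have "centred_normal (pair_walk n p (Suc \<eta> * n)) (2 * (T - \<tau> 1))"
    using pair_walk_normal[OF n order_refl, where a = 0 and p = p] by (simp add: pair_walk_def[abs_def] del: mult_Suc)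
  note mills = centred_normal_tail_mills[OF this _ u]
  have eq: "main_term u = 2 * (sqrt (2 * (T - \<tau> 1)) / (u * sqrt (2 * pi)) * exp (- (u\<^sup>2 / (2 * (2 * (T - \<tau> 1))))))"
  proof -
    have "sqrt (2 * (T - \<tau> 1)) / (u * sqrt (2 * pi)) = sqrt (T - \<tau> 1) / (u * sqrt pi)"
      by (simp only: real_sqrt_mult) simp
    then show ?thesis unfolding main_term_def by simp
  qed
  show "2 * prob {\<omega>\<in>space M. pair_walk n p (Suc \<eta> * n) \<omega> > u} \<le> main_term u"
    unfolding eq using mills(1) \<tau>_bounds(1) by (intro mult_left_mono) auto
  show "main_term u / (1 + 2 * (T - \<tau> 1) / u\<^sup>2) \<le> 2 * prob {\<omega>\<in>space M. pair_walk n p (Suc \<eta> * n) \<omega> > u}"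
    unfolding eq using mills(2) \<tau>_bounds(1) by (simp del: mult_Suc)
qed

lemma spread_upper_bound:
  obtains \<kappa> where "\<kappa> > 1 / (4 * (T - \<tau> 1))"
    "\<And>u. 0 < u \<Longrightarrow> prob (spread_event u) \<le> real (card separated_pairs) * main_term u
        + 2 * real (card \<Gamma>_pairs) * exp (- \<kappa> * u\<^sup>2)"
proof
  \<comment> \<open>a positive number even if \<open>\<eta> = 1\<close>, where \<open>stage_time 2\<close> is \<open>T\<close>\<close>
  let ?v = "(T - stage_time 2) + (T - \<tau> 1)"
  have s2: "\<tau> 1 < stage_time 2" "stage_time 2 \<le> T"
    using stage_time_less[of 1] stage_time_mono[of 2 "Suc \<eta>"] \<eta> by (auto simp: stage_time_simps numeral_2_eq_2)
  have v: "0 < ?v" "?v < 2 * (T - \<tau> 1)" "2 * (T - stage_time 2) \<le> ?v" using s2 \<tau>_bounds(1) by auto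
  show "1 / (2 * ?v) > 1 / (4 * (T - \<tau> 1))" using v by (intro divide_strict_left_mono) auto
  fix u :: real assume u: "0 < u"
  let ?e = "2 * exp (- (1 / (2 * ?v)) * u\<^sup>2)"
  have n: "prob (grid_event n u) \<le> real (card separated_pairs) * main_term u
      + 2 * real (card \<Gamma>_pairs) * exp (- (1 / (2 * ?v)) * u\<^sup>2)" if n: "0 < n" for n
  proof -
    have sep: "prob (passage n p 0 (Suc \<eta> * n) u) \<le> main_term u" if "separated p" for p
      using passage_levy[OF n, of 0 "Suc \<eta> * n" p u] separated_tail(1)[OF n that u]
      by (simp add: pair_walk_def del: mult_Suc)
    have nsep: "prob (passage n p 0 (Suc \<eta> * n) u) \<le> ?e" if "\<not> separated p" for p
    proof -
      have "prob (passage n p 0 (Suc \<eta> * n) u) \<le> 2 * exp (- (u\<^sup>2 / (2 * ?v)))"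
        using pair_variance_not_separated[OF n that] v u n
        by (intro passage_exp_bound) auto
      then show ?thesis by simp
    qed
    have "prob (grid_event n u) \<le> (\<Sum>p\<in>\<Gamma>_pairs. prob (passage n p 0 (Suc \<eta> * n) u))"
      using n by (intro finite_measure_subadditive_finite image_subsetI passage_event) auto
    also have "\<dots> \<le> (\<Sum>p\<in>\<Gamma>_pairs. (if separated p then main_term u else 0) + ?e)"
    proof (rule sum_mono)
      fix p
      show "prob (passage n p 0 (Suc \<eta> * n) u) \<le> (if separated p then main_term u else 0) + ?e"
        using sep[of p] nsep[of p] by (auto intro: add_increasing2)
    qed
    also have "\<dots> = real (card separated_pairs) * main_term u + real (card \<Gamma>_pairs) * ?e"
      by (simp add: sum.distrib sum.If_cases separated_pairs_def Int_def)
    finally show ?thesis by simp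
  qed
  show "prob (spread_event u) \<le> real (card separated_pairs) * main_term u
      + 2 * real (card \<Gamma>_pairs) * exp (- (1 / (2 * ?v)) * u\<^sup>2)"
    by (rule LIMSEQ_le_const2[OF grid_event_limit(1)[of 1 u]]) (use n in auto)
qed

text \<open>
  Here \<open>\<theta>\<close> and \<open>h\<close> of the introduction are chosen. The time \<open>T - h\<close> has to be a grid point, so \<open>h\<close> is
  the length of the last stage divided by an integer \<open>q\<close>, and the number of pieces per stage is a multiple
  of \<open>q\<close>. The factor 9 collects twice 2 for early passages, twice 2 for late rises, and 1 for the sum.
\<close>

lemma joint_passage_exp_bound:
  obtains \<kappa> q where "\<kappa> > 1 / (4 * (T - \<tau> 1))" "0 < (q :: nat)"
    "\<And>u r p p'. 0 < u \<Longrightarrow> p \<in> separated_pairs \<Longrightarrow> p' \<in> separated_pairs \<Longrightarrow> p \<noteq> p' \<Longrightarrow>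
      prob (passage (q * 2 ^ r) p 0 (Suc \<eta> * (q * 2 ^ r)) u \<inter> passage (q * 2 ^ r) p' 0 (Suc \<eta> * (q * 2 ^ r)) u)
        \<le> 9 * exp (- \<kappa> * u\<^sup>2)"
proof -
  define \<sigma> where "\<sigma> = T - \<tau> 1"
  define l where "l = T - \<tau> \<eta>"
  have \<sigma>l: "0 < \<sigma>" "0 < l" "l \<le> \<sigma>" using \<tau>_bounds by (auto simp: \<sigma>_def l_def)
  \<comment> \<open>the choice gives \<open>8 * \<sigma> - 2 * l < 8 * \<sigma> * (1 - \<theta>)\<^sup>2\<close>, with \<open>l\<close> to spare\<close>
  define \<theta> where "\<theta> = l / (16 * \<sigma>)"
  have \<theta>: "0 < \<theta>" "\<theta> < 1" using \<sigma>l by (auto simp: \<theta>_def)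
  obtain q where "l / (\<theta>\<^sup>2 * \<sigma>) < real q" using reals_Archimedean2 by blast
  then have q: "0 < q" and lq: "l / real q < \<theta>\<^sup>2 * \<sigma>"
  proof -
    assume a: "l / (\<theta>\<^sup>2 * \<sigma>) < real q"
    have "0 < l / (\<theta>\<^sup>2 * \<sigma>)" using \<sigma>l \<theta> by simp
    then show "0 < q" using a by (cases q) auto
    then show "l / real q < \<theta>\<^sup>2 * \<sigma>" using a \<sigma>l \<theta> by (simp add: field_simps)
  qed
  define h where "h = l / real q"
  have h: "0 < h" "h < \<theta>\<^sup>2 * \<sigma>" using lq q \<sigma>l by (auto simp: h_def)
  have "\<theta>\<^sup>2 * \<sigma> \<le> 1 * \<sigma>" using \<theta> \<sigma>l by (intro mult_right_mono) (auto simp: power_le_one)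
  then have h\<sigma>: "h < \<sigma>" using h by simp
  \<comment> \<open>the decay rates for early passage, for a late rise, and for the sum of the two walks\<close>
  define \<kappa>1 where "\<kappa>1 = 1 / (4 * (\<sigma> - h))"
  define \<kappa>2 where "\<kappa>2 = \<theta>\<^sup>2 / (4 * h)"
  define \<kappa>3 where "\<kappa>3 = (2 * (1 - \<theta>))\<^sup>2 / (2 * (8 * \<sigma> - 2 * l))"
  have k1: "\<kappa>1 > 1 / (4 * \<sigma>)" using h h\<sigma> by (auto simp: \<kappa>1_def intro!: divide_strict_left_mono)
  have k2: "\<kappa>2 > 1 / (4 * \<sigma>)" using h \<sigma>l by (simp add: \<kappa>2_def field_simps)
  have k3: "\<kappa>3 > 1 / (4 * \<sigma>)"
  proof -
    have "16 * \<theta> * \<sigma> = l" using \<sigma>l by (simp add: \<theta>_def)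
    moreover have "8 * \<sigma> * (1 - 2 * \<theta>) \<le> 8 * \<sigma> * (1 - \<theta>)\<^sup>2"
      using \<sigma>l by (intro mult_left_mono) (auto simp: power2_eq_square algebra_simps)
    ultimately have "8 * \<sigma> - 2 * l < 8 * \<sigma> * (1 - \<theta>)\<^sup>2" using \<sigma>l by (simp add: algebra_simps)
    moreover have "(2 * (1 - \<theta>))\<^sup>2 = 4 * (1 - \<theta>)\<^sup>2" by (simp only: power_mult_distrib) simp
    ultimately show ?thesis using \<sigma>l unfolding \<kappa>3_def by (simp add: field_simps)
  qed
  define \<kappa> where "\<kappa> = min \<kappa>1 (min \<kappa>2 \<kappa>3)"
  have le: "exp (- k * u\<^sup>2) \<le> exp (- \<kappa> * u\<^sup>2)" if "\<kappa> \<le> k" for k u :: real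
    using that by (simp add: mult_right_mono)
  have "prob (passage (q * 2 ^ r) p 0 (Suc \<eta> * (q * 2 ^ r)) u \<inter> passage (q * 2 ^ r) p' 0 (Suc \<eta> * (q * 2 ^ r)) u)
        \<le> 9 * exp (- \<kappa> * u\<^sup>2)"
    if u: "0 < u" and p: "p \<in> separated_pairs" "p' \<in> separated_pairs" "p \<noteq> p'" for u r p p'
  proof -
    define n where "n = q * 2 ^ r"
    define L where "L = Suc \<eta> * n"
    define b where "b = \<eta> * n + (n - 2 ^ r)"
    have n: "0 < n" "2 ^ r \<le> n" using q by (auto simp: n_def)
    have b: "n \<le> b" "\<eta> * n \<le> b" "b \<le> L" using n trans_le_add1[OF mult_le_mono1[OF \<eta>, of n], of "n - 2 ^ r"]
      by (auto simp: b_def L_def)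
    have "stage_time \<eta> + (stage_time (Suc \<eta>) - stage_time \<eta>) * real (n - 2 ^ r) / real n = T - h"
      using n q by (simp add: stage_time_simps h_def l_def of_nat_diff n_def field_simps)
    then have gb: "grid n b = T - h" using grid_stage[OF n(1), of "n - 2 ^ r" \<eta>] by (simp add: b_def)
    have gL: "grid n L = T" using grid_multiple[OF n(1), of "Suc \<eta>"] by (simp add: L_def stage_time_simps)
    have sep: "separated p" "separated p'" "p \<in> \<Gamma>_pairs" "p' \<in> \<Gamma>_pairs" using p by (auto simp: separated_pairs_def)
    have early: "prob (passage n x 0 b u) \<le> 2 * exp (- \<kappa> * u\<^sup>2)" if "separated x" for x
    proof -
      have "prob (passage n x 0 b u) \<le> 2 * exp (- (u\<^sup>2 / (2 * (2 * (\<sigma> - h)))))"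
        using b n u h\<sigma> pair_variance_separated[OF n(1) b(1) b(3)[unfolded L_def] that] gb
        by (intro passage_exp_bound) (auto simp: L_def \<sigma>_def)
      also have "- (u\<^sup>2 / (2 * (2 * (\<sigma> - h)))) = - \<kappa>1 * u\<^sup>2" by (simp add: \<kappa>1_def)
      also have "2 * exp (- \<kappa>1 * u\<^sup>2) \<le> 2 * exp (- \<kappa> * u\<^sup>2)" using le[of \<kappa>1] by (simp add: \<kappa>_def)
      finally show ?thesis .
    qed
    have late: "prob (passage n x b L (\<theta> * u)) \<le> 2 * exp (- \<kappa> * u\<^sup>2)" for x
    proof -
      have "pair_variance n x b L \<le> 2 * h"
        using pair_variance_le[OF n(1) b(3)] gb gL by (simp add: L_def)
      then have "prob (passage n x b L (\<theta> * u)) \<le> 2 * exp (- ((\<theta> * u)\<^sup>2 / (2 * (2 * h))))"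
        using b n u h \<theta> by (intro passage_exp_bound) (auto simp: L_def)
      also have "- ((\<theta> * u)\<^sup>2 / (2 * (2 * h))) = - \<kappa>2 * u\<^sup>2" by (simp add: \<kappa>2_def power_mult_distrib)
      also have "2 * exp (- \<kappa>2 * u\<^sup>2) \<le> 2 * exp (- \<kappa> * u\<^sup>2)" using le[of \<kappa>2] by (simp add: \<kappa>_def)
      finally show ?thesis .
    qed
    have both: "prob {\<omega>\<in>space M. pair_walk n p b \<omega> + pair_walk n p' b \<omega> > 2 * (1 - \<theta>) * u} \<le> exp (- \<kappa> * u\<^sup>2)"
    proof -
      have "prob {\<omega>\<in>space M. pair_walk n p b \<omega> + pair_walk n p' b \<omega> > 2 * (1 - \<theta>) * u}
        \<le> exp (- ((2 * (1 - \<theta>) * u)\<^sup>2 / (2 * (8 * (T - \<tau> 1) - 2 * (T - \<tau> \<eta>)))))"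
        using sep p u \<theta> b n by (intro joint_walk_exp_bound) (auto simp: L_def)
      also have "- ((2 * (1 - \<theta>) * u)\<^sup>2 / (2 * (8 * (T - \<tau> 1) - 2 * (T - \<tau> \<eta>)))) = - \<kappa>3 * u\<^sup>2"
        by (simp add: \<kappa>3_def \<sigma>_def l_def power_mult_distrib)
      also have "exp (- \<kappa>3 * u\<^sup>2) \<le> exp (- \<kappa> * u\<^sup>2)" using le[of \<kappa>3] by (simp add: \<kappa>_def)
      finally show ?thesis .
    qed
    let ?J = "{\<omega>\<in>space M. pair_walk n p b \<omega> + pair_walk n p' b \<omega> > 2 * (1 - \<theta>) * u}"
    have ev: "passage n x a c w \<in> events" if "c \<le> L" for x a c w
      using that n(1) unfolding L_def by (intro passage_event)
    have wm: "random_variable borel (pair_walk n x b)" for x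
      using pair_walk_measurable[OF n(1), of b x 0] b by (simp add: pair_walk_def[abs_def] L_def)
    have Jev: "?J \<in> events" using wm by measurable
    have "prob (passage n p 0 L u \<inter> passage n p' 0 L u) \<le>
      prob (passage n p 0 b u \<union> passage n p' 0 b u \<union> passage n p b L (\<theta> * u) \<union> passage n p' b L (\<theta> * u) \<union> ?J)"
      by (intro finite_measure_mono[OF joint_passage_subset[OF b(3)]] sets.Un ev Jev b(3) order_refl)
    also have "\<dots> \<le> prob (passage n p 0 b u) + prob (passage n p' 0 b u) + prob (passage n p b L (\<theta> * u))
       + prob (passage n p' b L (\<theta> * u)) + prob ?J"
      by (intro measure_Un_le[THEN order_trans] add_right_mono sets.Un ev Jev b(3) order_refl)
    also have "\<dots> \<le> 9 * exp (- \<kappa> * u\<^sup>2)"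
      using early[OF sep(1)] early[OF sep(2)] late[of p] late[of p'] both by simp
    finally show ?thesis by (simp add: n_def L_def)
  qed
  moreover have \<kappa>: "\<kappa> > 1 / (4 * (T - \<tau> 1))" using k1 k2 k3 by (simp add: \<kappa>_def \<sigma>_def)
  ultimately show ?thesis by (intro that[OF \<kappa> q])
qed

text \<open>
  For a fixed \<open>\<epsilon>\<close> the mesh of the grid tends to 0, which removes the big steps; then \<open>\<epsilon>\<close> tends to 0, and
  continuity of the main term in the level removes the overshoot.
\<close>

lemma spread_lower_bound:
  obtains \<kappa> where "\<kappa> > 1 / (4 * (T - \<tau> 1))"
    "\<And>u. 0 < u \<Longrightarrow> real (card separated_pairs) * (main_term u / (1 + 2 * (T - \<tau> 1) / u\<^sup>2))
      \<le> prob (spread_event u) + 9 * (real (card separated_pairs))\<^sup>2 * exp (- \<kappa> * u\<^sup>2)"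
proof -
  obtain \<kappa> q where \<kappa>: "\<kappa> > 1 / (4 * (T - \<tau> 1))" and q: "0 < (q :: nat)" and
    joint: "\<And>u r p p'. 0 < u \<Longrightarrow> p \<in> separated_pairs \<Longrightarrow> p' \<in> separated_pairs \<Longrightarrow> p \<noteq> p' \<Longrightarrow>
      prob (passage (q * 2 ^ r) p 0 (Suc \<eta> * (q * 2 ^ r)) u \<inter> passage (q * 2 ^ r) p' 0 (Suc \<eta> * (q * 2 ^ r)) u)
        \<le> 9 * exp (- \<kappa> * u\<^sup>2)"
    using joint_passage_exp_bound by blast
  define K where "K = real (card separated_pairs)"
  define low where "low u = main_term u / (1 + 2 * (T - \<tau> 1) / u\<^sup>2)" for u
  have fin: "finite separated_pairs" by (simp add: separated_pairs_def)
  have T: "0 < T" using \<tau>_pos \<tau>_bounds(1) by simp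
  have grid_bound: "K * low (u + 2 * \<epsilon>) \<le> prob (spread_event u) + 9 * K\<^sup>2 * exp (- \<kappa> * u\<^sup>2)
      + K * (real (Suc \<eta> * (q * 2 ^ r)) * exp (- (\<epsilon>\<^sup>2 / (4 * T)) * real (q * 2 ^ r)))"
    if u: "0 < u" and \<epsilon>: "0 < \<epsilon>" for u \<epsilon> r
  proof -
    define n where "n = q * 2 ^ r"
    have n: "0 < n" using q by (simp add: n_def)
    let ?G = "\<lambda>p. passage n p 0 (Suc \<eta> * n) u"
    let ?err = "real (Suc \<eta> * n) * exp (- (\<epsilon>\<^sup>2 / (4 * T)) * real n)"
    have G: "?G p \<in> events" for p using n by (intro passage_event) auto
    have "low (u + 2 * \<epsilon>) \<le> prob (?G p) + ?err" if "p \<in> separated_pairs" for p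
    proof -
      have "low (u + 2 * \<epsilon>) \<le> 2 * prob {\<omega>\<in>space M. pair_walk n p (Suc \<eta> * n) \<omega> > u + 2 * \<epsilon>}"
        unfolding low_def using that u \<epsilon> n by (intro separated_tail) (auto simp: separated_pairs_def)
      also have "\<dots> \<le> prob (?G p) + ?err"
        using u \<epsilon> n by (intro passage_lower_bound) auto
      finally show ?thesis .
    qed
    then have "(\<Sum>p\<in>separated_pairs. low (u + 2 * \<epsilon>)) \<le> (\<Sum>p\<in>separated_pairs. prob (?G p) + ?err)"
      by (intro sum_mono)
    then have "K * low (u + 2 * \<epsilon>) \<le> (\<Sum>p\<in>separated_pairs. prob (?G p)) + K * ?err"
      by (simp add: sum.distrib K_def)
    also have "(\<Sum>p\<in>separated_pairs. prob (?G p)) \<le> prob (\<Union>p\<in>separated_pairs. ?G p)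
        + (\<Sum>p\<in>separated_pairs. \<Sum>p'\<in>separated_pairs - {p}. prob (?G p \<inter> ?G p'))"
      by (intro bonferroni_lower fin G)
    also have "prob (\<Union>p\<in>separated_pairs. ?G p) \<le> prob (spread_event u)"
    proof (intro finite_measure_mono grid_event_limit(2)[OF q])
      show "(\<Union>p\<in>separated_pairs. ?G p) \<subseteq> spread_event u"
        using grid_event_subset[OF n, of u] unfolding separated_pairs_def by blast
    qed
    also have "(\<Sum>p\<in>separated_pairs. \<Sum>p'\<in>separated_pairs - {p}. prob (?G p \<inter> ?G p'))
       \<le> (\<Sum>p\<in>separated_pairs. \<Sum>p'\<in>separated_pairs. 9 * exp (- \<kappa> * u\<^sup>2))"
    proof (intro sum_mono)
      fix p assume p: "p \<in> separated_pairs"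
      have "(\<Sum>p'\<in>separated_pairs - {p}. prob (?G p \<inter> ?G p')) \<le> (\<Sum>p'\<in>separated_pairs - {p}. 9 * exp (- \<kappa> * u\<^sup>2))"
        using joint[OF u p, of _ r] by (intro sum_mono) (auto simp: n_def simp del: mult_Suc)
      also have "\<dots> \<le> (\<Sum>p'\<in>separated_pairs. 9 * exp (- \<kappa> * u\<^sup>2))"
        using fin by (intro sum_mono2) auto
      finally show "(\<Sum>p'\<in>separated_pairs - {p}. prob (?G p \<inter> ?G p')) \<le> (\<Sum>p'\<in>separated_pairs. 9 * exp (- \<kappa> * u\<^sup>2))" .
    qed
    also have "\<dots> = 9 * K\<^sup>2 * exp (- \<kappa> * u\<^sup>2)" by (simp add: K_def power2_eq_square)
    finally show ?thesis by (simp add: n_def)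
  qed
  have \<epsilon>_bound: "K * low (u + 2 * \<epsilon>) \<le> prob (spread_event u) + 9 * K\<^sup>2 * exp (- \<kappa> * u\<^sup>2)"
    if u: "0 < u" and \<epsilon>: "0 < \<epsilon>" for u \<epsilon>
  proof -
    define c where "c = \<epsilon>\<^sup>2 / (4 * T)"
    have c: "0 < c" using \<epsilon> T by (simp add: c_def)
    have "(\<lambda>n. real n * exp (- c) ^ n) \<longlonglongrightarrow> 0"
      using c by (intro powser_times_n_limit_0) auto
    moreover have "filterlim (\<lambda>r. q * 2 ^ r) sequentially sequentially"
    proof (rule filterlim_subseq, rule strict_monoI_Suc)
      show "q * 2 ^ r < q * 2 ^ Suc r" for r using q by simp
    qed
    ultimately have "(\<lambda>r. real (q * 2 ^ r) * exp (- c) ^ (q * 2 ^ r)) \<longlonglongrightarrow> 0"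
      by (rule filterlim_compose)
    then have "(\<lambda>r. prob (spread_event u) + 9 * K\<^sup>2 * exp (- \<kappa> * u\<^sup>2)
        + K * (real (Suc \<eta>) * (real (q * 2 ^ r) * exp (- c) ^ (q * 2 ^ r))))
      \<longlonglongrightarrow> prob (spread_event u) + 9 * K\<^sup>2 * exp (- \<kappa> * u\<^sup>2) + K * (real (Suc \<eta>) * 0)"
      by (intro tendsto_intros)
    moreover have "exp (- c) ^ n = exp (- c * real n)" for n
      by (simp add: exp_of_nat_mult[symmetric] mult.commute)
    ultimately have "(\<lambda>r. prob (spread_event u) + 9 * K\<^sup>2 * exp (- \<kappa> * u\<^sup>2)
        + K * (real (Suc \<eta> * (q * 2 ^ r)) * exp (- c * real (q * 2 ^ r))))
      \<longlonglongrightarrow> prob (spread_event u) + 9 * K\<^sup>2 * exp (- \<kappa> * u\<^sup>2)"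
      by (simp add: mult.assoc del: mult_Suc of_nat_Suc)
    then show ?thesis
      by (rule LIMSEQ_le_const) (use grid_bound[OF u \<epsilon>] in \<open>auto simp: c_def simp del: mult_Suc\<close>)
  qed
  have "K * low u \<le> prob (spread_event u) + 9 * K\<^sup>2 * exp (- \<kappa> * u\<^sup>2)" if u: "0 < u" for u
  proof -
    have "continuous (at_right 0) (\<lambda>\<epsilon>. K * low (u + 2 * \<epsilon>))"
      unfolding low_def main_term_def using u \<tau>_bounds(1)
      by (intro continuous_intros) (auto simp: add_pos_nonneg add_nonneg_eq_0_iff)
    then have "((\<lambda>\<epsilon>. K * low (u + 2 * \<epsilon>)) \<longlongrightarrow> K * low (u + 2 * 0)) (at_right 0)"
      by (simp add: continuous_within)
    then have "K * low (u + 2 * 0) \<le> prob (spread_event u) + 9 * K\<^sup>2 * exp (- \<kappa> * u\<^sup>2)"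
      by (rule tendsto_upperbound) (use \<epsilon>_bound[OF u] in \<open>auto intro!: eventually_at_rightI[of 0 1]\<close>)
    then show ?thesis by simp
  qed
  then show ?thesis using \<kappa> that unfolding K_def low_def by blast
qed

text \<open>
  Each residue class modulo \<open>N 1\<close> has \<open>P \<eta> div N 1\<close> members among the branches.
\<close>

lemma card_separated_pairs:
  "real (card separated_pairs) = (real (P \<eta>))\<^sup>2 * ((real (N 1) - 1) / real (N 1))"
proof -
  obtain R where R: "P \<eta> = N 1 * R" using P_dvd[OF \<eta>] by (auto simp: offspring_prod_def elim: dvdE)
  have N1: "0 < N 1" using N_pos[of 1] \<eta> by simp
  have class_card: "card {b \<in> {0..<P \<eta>}. b mod N 1 = a mod N 1} = R" for a
  proof -
    have "bij_betw (\<lambda>k. N 1 * k + a mod N 1) {0..<R} {b \<in> {0..<P \<eta>}. b mod N 1 = a mod N 1}"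
    proof (rule bij_betwI[where g = "\<lambda>b. b div N 1"])
      show "(\<lambda>k. N 1 * k + a mod N 1) \<in> {0..<R} \<rightarrow> {b \<in> {0..<P \<eta>}. b mod N 1 = a mod N 1}"
      proof (intro funcsetI)
        fix k assume k: "k \<in> {0..<R}"
        have "N 1 * k + a mod N 1 < N 1 * Suc k" using N1 by simp
        also have "\<dots> \<le> P \<eta>" unfolding R using k by (intro mult_le_mono2) auto
        finally show "N 1 * k + a mod N 1 \<in> {b \<in> {0..<P \<eta>}. b mod N 1 = a mod N 1}" by simp
      qed
      show "(\<lambda>b. b div N 1) \<in> {b \<in> {0..<P \<eta>}. b mod N 1 = a mod N 1} \<rightarrow> {0..<R}"
        using R N1 by (auto intro: less_mult_imp_div_less simp: mult.commute)
      show "N 1 * (b div N 1) + a mod N 1 = b" if "b \<in> {b \<in> {0..<P \<eta>}. b mod N 1 = a mod N 1}" for b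
        using that by (auto simp: mult_div_mod_eq dest: sym)
    qed (use N1 in auto)
    from bij_betw_same_card[OF this] show ?thesis by simp
  qed
  have "separated_pairs = (SIGMA a:{0..<P \<eta>}. {0..<P \<eta>} - {b \<in> {0..<P \<eta>}. b mod N 1 = a mod N 1})"
    by (auto simp: separated_pairs_def separated_def offspring_prod_def)
  then have "card separated_pairs = (\<Sum>a\<in>{0..<P \<eta>}. card ({0..<P \<eta>} - {b \<in> {0..<P \<eta>}. b mod N 1 = a mod N 1}))"
    by simp
  also have "\<dots> = (\<Sum>a\<in>{0..<P \<eta>}. P \<eta> - R)"
  proof (intro sum.cong refl)
    fix a
    have "card ({0..<P \<eta>} - {b \<in> {0..<P \<eta>}. b mod N 1 = a mod N 1})
      = card {0..<P \<eta>} - card {b \<in> {0..<P \<eta>}. b mod N 1 = a mod N 1}"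
      by (rule card_Diff_subset) auto
    then show "card ({0..<P \<eta>} - {b \<in> {0..<P \<eta>}. b mod N 1 = a mod N 1}) = P \<eta> - R"
      by (simp only: class_card card_atLeastLessThan diff_zero)
  qed
  finally have "real (card separated_pairs) = real (P \<eta>) * (real (P \<eta>) - real R)"
    using R N1 by (simp add: of_nat_diff)
  also have "\<dots> = (real (P \<eta>))\<^sup>2 * ((real (N 1) - 1) / real (N 1))"
    using N1 by (simp add: R power2_eq_square field_simps)
  finally show ?thesis .
qed

section \<open>Asymptotics\<close>

lemma exp_negligible:
  assumes "\<kappa> > 1 / (4 * (T - \<tau> 1))"
  shows "((\<lambda>u. exp (- \<kappa> * u\<^sup>2) / main_term u) \<longlongrightarrow> 0) at_top"
proof -
  define \<delta> where "\<delta> = \<kappa> - 1 / (4 * (T - \<tau> 1))"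
  define c where "c = sqrt pi / (2 * sqrt (T - \<tau> 1))"
  have \<delta>: "0 < \<delta>" using assms by (simp add: \<delta>_def)
  have c: "0 < c" using \<tau>_bounds(1) by (simp add: c_def)
  have eq: "exp (- \<kappa> * u\<^sup>2) / main_term u = c * (u * exp (- \<delta> * u\<^sup>2))" if "0 < u" for u
  proof -
    have "- \<delta> * u\<^sup>2 = - \<kappa> * u\<^sup>2 + u\<^sup>2 / (4 * (T - \<tau> 1))" by (simp add: \<delta>_def algebra_simps)
    then have "exp (- \<delta> * u\<^sup>2) = exp (- \<kappa> * u\<^sup>2) / exp (- (u\<^sup>2 / (4 * (T - \<tau> 1))))"
      by (simp only: exp_diff[symmetric]) simp
    then show ?thesis using that by (simp add: main_term_def c_def)
  qed
  have "((\<lambda>u. c * (u * exp (- \<delta> * u\<^sup>2))) \<longlongrightarrow> 0) at_top"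
  proof (rule tendsto_sandwich[where f = "\<lambda>_. 0" and h = "\<lambda>u. c / \<delta> * inverse u"])
    show "\<forall>\<^sub>F u in at_top. 0 \<le> c * (u * exp (- \<delta> * u\<^sup>2))"
      using c by (intro eventually_mono[OF eventually_ge_at_top[of 0]]) auto
    show "\<forall>\<^sub>F u in at_top. c * (u * exp (- \<delta> * u\<^sup>2)) \<le> c / \<delta> * inverse u"
    proof (intro eventually_mono[OF eventually_gt_at_top[of 0]])
      fix u :: real assume u: "0 < u"
      have "\<delta> * u\<^sup>2 \<le> exp (\<delta> * u\<^sup>2)" using exp_ge_add_one_self[of "\<delta> * u\<^sup>2"] by linarith
      then have "u * exp (- \<delta> * u\<^sup>2) \<le> 1 / \<delta> * inverse u"
        using u \<delta> by (simp add: exp_minus field_simps power2_eq_square)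
      then show "c * (u * exp (- \<delta> * u\<^sup>2)) \<le> c / \<delta> * inverse u"
        using mult_left_mono[OF _ less_imp_le[OF c]] by fastforce
    qed
    show "((\<lambda>u. c / \<delta> * inverse u) \<longlongrightarrow> 0) at_top"
      by (rule tendsto_mult_right_zero[OF tendsto_inverse_0_at_top[OF filterlim_ident]])
  qed simp
  then show ?thesis
    by (rule Lim_transform_eventually) (rule eventually_mono[OF eventually_gt_at_top[of 0]], rule eq[symmetric])
qed

lemma main_term_pos: "0 < u \<Longrightarrow> 0 < main_term u"
  using \<tau>_bounds(1) by (simp add: main_term_def)

text \<open>
  Dividing by the main term, rather than by its multiple, keeps the statement meaningful when there are no
  separated pairs.
\<close>

lemma spread_ratio_limit:
  "((\<lambda>u. prob (spread_event u) / main_term u) \<longlongrightarrow> real (card separated_pairs)) at_top"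
proof -
  define K where "K = real (card separated_pairs)"
  obtain \<kappa>1 where \<kappa>1: "\<kappa>1 > 1 / (4 * (T - \<tau> 1))"
    and up: "\<And>u. 0 < u \<Longrightarrow> prob (spread_event u) \<le> K * main_term u + 2 * real (card \<Gamma>_pairs) * exp (- \<kappa>1 * u\<^sup>2)"
    unfolding K_def using spread_upper_bound by blast
  obtain \<kappa>2 where \<kappa>2: "\<kappa>2 > 1 / (4 * (T - \<tau> 1))"
    and low: "\<And>u. 0 < u \<Longrightarrow> K * (main_term u / (1 + 2 * (T - \<tau> 1) / u\<^sup>2))
      \<le> prob (spread_event u) + 9 * K\<^sup>2 * exp (- \<kappa>2 * u\<^sup>2)"
    unfolding K_def using spread_lower_bound by blast
  let ?r = "\<lambda>\<kappa> u. exp (- \<kappa> * u\<^sup>2) / main_term u"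
  have "((\<lambda>u. prob (spread_event u) / main_term u) \<longlongrightarrow> K) at_top"
  proof (rule tendsto_sandwich[where f = "\<lambda>u. K / (1 + 2 * (T - \<tau> 1) * (inverse u)\<^sup>2) - 9 * K\<^sup>2 * ?r \<kappa>2 u"
        and h = "\<lambda>u. K + 2 * real (card \<Gamma>_pairs) * ?r \<kappa>1 u"])
    show "\<forall>\<^sub>F u in at_top. prob (spread_event u) / main_term u \<le> K + 2 * real (card \<Gamma>_pairs) * ?r \<kappa>1 u"
    proof (intro eventually_mono[OF eventually_gt_at_top[of 0]])
      fix u :: real assume u: "0 < u"
      show "prob (spread_event u) / main_term u \<le> K + 2 * real (card \<Gamma>_pairs) * ?r \<kappa>1 u"
        using divide_right_mono[OF up[OF u] less_imp_le[OF main_term_pos[OF u]]] main_term_pos[OF u]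
        by (simp add: add_divide_distrib)
    qed
    show "\<forall>\<^sub>F u in at_top. K / (1 + 2 * (T - \<tau> 1) * (inverse u)\<^sup>2) - 9 * K\<^sup>2 * ?r \<kappa>2 u \<le> prob (spread_event u) / main_term u"
    proof (intro eventually_mono[OF eventually_gt_at_top[of 0]])
      fix u :: real assume u: "0 < u"
      have "(K * (main_term u / (1 + 2 * (T - \<tau> 1) / u\<^sup>2))) / main_term u = K / (1 + 2 * (T - \<tau> 1) * (inverse u)\<^sup>2)"
        using main_term_pos[OF u] by (simp add: power_inverse divide_inverse)
      then show "K / (1 + 2 * (T - \<tau> 1) * (inverse u)\<^sup>2) - 9 * K\<^sup>2 * ?r \<kappa>2 u \<le> prob (spread_event u) / main_term u"
        using divide_right_mono[OF low[OF u] less_imp_le[OF main_term_pos[OF u]]]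
        by (simp add: add_divide_distrib)
    qed
    have "((\<lambda>u. K / (1 + 2 * (T - \<tau> 1) * (inverse u)\<^sup>2) - 9 * K\<^sup>2 * ?r \<kappa>2 u)
        \<longlongrightarrow> K / (1 + 2 * (T - \<tau> 1) * 0\<^sup>2) - 9 * K\<^sup>2 * 0) at_top"
      by (intro tendsto_intros exp_negligible \<kappa>2 tendsto_inverse_0_at_top filterlim_ident) auto
    then show "((\<lambda>u. K / (1 + 2 * (T - \<tau> 1) * (inverse u)\<^sup>2) - 9 * K\<^sup>2 * ?r \<kappa>2 u) \<longlongrightarrow> K) at_top" by simp
    have "((\<lambda>u. K + 2 * real (card \<Gamma>_pairs) * ?r \<kappa>1 u) \<longlongrightarrow> K + 2 * real (card \<Gamma>_pairs) * 0) at_top"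
      by (intro tendsto_intros exp_negligible \<kappa>1)
    then show "((\<lambda>u. K + 2 * real (card \<Gamma>_pairs) * ?r \<kappa>1 u) \<longlongrightarrow> K) at_top" by simp
  qed
  then show ?thesis by (simp add: K_def)
qed

end

theorem theorem3p2:
  fixes M :: "'a measure" and T :: real and \<eta> :: nat and \<tau> :: "nat \<Rightarrow> real"
    and N :: "nat \<Rightarrow> nat" and W :: "nat \<Rightarrow> nat \<Rightarrow> real \<Rightarrow> 'a \<Rightarrow> real"
  assumes "prob_space M" and "0 < T" and "1 \<le> \<eta>"
    and "0 < \<tau> 1" and "\<And>i. 1 \<le> i \<Longrightarrow> i < \<eta> \<Longrightarrow> \<tau> i < \<tau> (Suc i)" and "\<tau> \<eta> < T"
    and "\<And>i. 1 \<le> i \<Longrightarrow> i \<le> \<eta> \<Longrightarrow> 1 \<le> N i"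
    and "tree_driver M \<eta> N W"
  shows "(N 1 \<ge> 2 \<longrightarrow>
           (\<lambda>u::real. measure M (tree_spread_event M T \<eta> N \<tau> W u)) \<sim>[at_top]
           (\<lambda>u. real (offspring_prod N \<eta>) ^ 2 * ((real (N 1) - 1) / real (N 1)) *
             (2 * sqrt (T - \<tau> 1) / (u * sqrt pi)) * exp (- (u ^ 2 / (4 * (T - \<tau> 1)))))) \<and>
         (N 1 = 1 \<longrightarrow>
           (\<lambda>u::real. measure M (tree_spread_event M T \<eta> N \<tau> W u)) \<in>
           o[at_top](\<lambda>u. 2 * sqrt (T - \<tau> 1) / (u * sqrt pi) * exp (- (u ^ 2 / (4 * (T - \<tau> 1))))))"
proof -
  interpret prob_space M by fact
  interpret decision_tree M T \<eta> \<tau> N W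
    using assms by unfold_locales auto
  let ?K = "real (P \<eta>) ^ 2 * ((real (N 1) - 1) / real (N 1))"
  have lim: "((\<lambda>u. prob (spread_event u) / main_term u) \<longlongrightarrow> ?K) at_top"
    using spread_ratio_limit by (simp add: card_separated_pairs)
  show ?thesis
  proof (intro conjI impI)
    assume "2 \<le> N 1"
    then have K: "?K \<noteq> 0" using P_pos[of \<eta>] by auto
    have "((\<lambda>u. prob (spread_event u) / main_term u / ?K) \<longlongrightarrow> ?K / ?K) at_top"
      using lim K by (intro tendsto_divide tendsto_const)
    then have "((\<lambda>u. prob (spread_event u) / (?K * main_term u)) \<longlongrightarrow> 1) at_top"
      using K by (simp add: divide_divide_eq_left mult.commute)
    then have "prob \<circ> spread_event \<sim>[at_top] (\<lambda>u. ?K * main_term u)"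
      by (intro asymp_equivI') (simp add: o_def)
    then show "(\<lambda>u. prob (spread_event u)) \<sim>[at_top] (\<lambda>u. ?K * (2 * sqrt (T - \<tau> 1) / (u * sqrt pi)) * exp (- (u ^ 2 / (4 * (T - \<tau> 1)))))"
      by (simp add: o_def main_term_def mult.assoc)
  next
    assume "N 1 = 1"
    then have "((\<lambda>u. prob (spread_event u) / main_term u) \<longlongrightarrow> 0) at_top" using lim by simp
    moreover have "\<forall>\<^sub>F u in at_top. main_term u \<noteq> 0"
      using main_term_pos by (intro eventually_mono[OF eventually_gt_at_top[of 0]]) force
    ultimately have "(\<lambda>u. prob (spread_event u)) \<in> o[at_top](main_term)"
      by (intro smalloI_tendsto)
    then show "(\<lambda>u. prob (spread_event u)) \<in> o[at_top](\<lambda>u. 2 * sqrt (T - \<tau> 1) / (u * sqrt pi) * exp (- (u ^ 2 / (4 * (T - \<tau> 1)))))"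
      by (simp add: main_term_def[abs_def])
  qed
qed

end
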